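(* Consider $n$ agents, each agent $i\in[n]$ having $\theta_i^*\in\Theta_i$ and satisfying the noise assumption, and let $x_{\mathrm{des}}=(x_{1,\mathrm{des}},\dots,x_{n,\mathrm{des}})\in\prod_{i}\operatorname{int}\mathcal X_i$. Run the RAID algorithm independently for each agent with parameters $\gamma\in[\tfrac23,1)$ and $\sigma^2>0$. Then for every $i\in[n]$, \[ \|\hat\theta_i(t)-\theta_i^*\|_2^2=O(t^{-\gamma})\quad\text{a.s.}, \] and the planner's regret $R_t=\sum_{\tau=1}^t\|x(\tau)-x_{\mathrm{des}}\|_2^2$, where $x(\tau)=(x_1(\tau),\dots,x_n(\tau))^\top$, satisfies \[ R_t=O(t^\gamma\log t)\quad\text{a.s.} \]
   Context: For each $i\in[n]$: $\mathcal X_i\subset\mathbb R$ is a compact interval with nonempty interior; $\Phi(x)=(x,x^2,\dots,x^d)^\top$; $\Theta_i=\{\theta\in\mathbb R^d: m_i\le\theta^\top\nabla^2\Phi(x)\le M_i\ \forall x\in\mathcal X_i\}$ for constants $0<m_i\le M_i$. Best response: $x_i^*(p)=\arg\min_{x\in\mathcal X_i}(\theta_i^{*\top}\Phi(x)+px)$. At time $\tau$ the planner issues $p_i(\tau)$, observes $x_i(\tau)=x_i^*(p_i(\tau))$ and a signal $\hat p_i(\tau)$ which, whenever $x_i(\tau)\in\operatorname{int}\mathcal X_i$, equals $-\theta_i^{*\top}\nabla\Phi(x_i(\tau))+e_i(\tau)$. Noise assumption: $\{e_i(t)\}$ i.i.d., zero-mean, $\sup_t\mathbb E|e_i(t)|^a<\infty$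 for some $a>2$, $e_i(t)$ independent of $x_i(t)$ (and of the probing noise). Notation: $\xi_i(\tau)=\nabla\Phi(x_i(\tau))$, $\delta_i(\tau)=\mathbf 1\{x_i(\tau)\in\operatorname{int}\mathcal X_i\}$. RAID algorithm (per agent $i$): set $A(\tau)=\tau^\gamma\log\tau$ (with the convention that the exploration condition holds whenever $A(\tau-1)\le0$); initialize $\Sigma_i(0)\succ0$ and $\hat\theta_i(0)$ arbitrary. For $\tau=1,2,\dots$: (exploration) if $\operatorname{tr}(\Sigma_i(\tau-1))>A(\tau-1)^{-1}$, issue $p_i(\tau)\sim\mathcal N(0,\sigma^2)$ drawn independently of everything else, and update $\hat\theta_i(\tau)=\hat\theta_i(\tau-1)-\delta_i(\tau)\Sigma_i(\tau)\xi_i(\tau)(\hat p_i(\tau)+\xi_i(\tau)^\top\hat\theta_i(\tau-1))$, $\Sigma_i(\tau)^{-1}=\Sigma_i(\tau-1)^{-1}+\delta_i(\tau)\xi_i(\tau)\xi_i(\tau)^\top$; (exploitation) otherwise, issue $p_i(\tau)=-\hat\theta_i(\tau-1)^\top\nabla\Phi(x_{i,\mathrm{des}})$ and keep $\Sigma_i(\tau)=\Sigma_i(\tau-1)$, $\hat\theta_i(\tau)=\hat\theta_i(\tau-1)$. *)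

theory Defs
  imports "HOL-Probability.Probability" "HOL-Library.Landau_Symbols" "Jordan_Normal_Form.Matrix"
begin

definition Phi :: "nat \<Rightarrow> real \<Rightarrow> real vec" where
  "Phi d x = vec d (\<lambda>k. x ^ (k+1))"

definition dPhi :: "nat \<Rightarrow> real \<Rightarrow> real vec" where
  "dPhi d x = vec d (\<lambda>k. real (k+1) * x ^ k)"

(* second derivative: k \<mapsto> (k+1) k x^(k-1)  (equal to 0 for k = 0) *)
definition d2Phi :: "nat \<Rightarrow> real \<Rightarrow> real vec" where
  "d2Phi d x = vec d (\<lambda>k. real (k+1) * real k * x ^ (k-1))"

definition Theta :: "nat \<Rightarrow> real \<Rightarrow> real \<Rightarrow> real \<Rightarrow> real \<Rightarrow> real vec set" where
  "Theta d lo hi m M = {\<theta> \<in> carrier_vec d. \<forall>x\<in>{lo..hi}. m \<le> \<theta> \<bullet> d2Phi d x \<and> \<theta> \<bullet> d2Phi d x \<le> M}"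

definition best_response :: "nat \<Rightarrow> real \<Rightarrow> real \<Rightarrow> real vec \<Rightarrow> real \<Rightarrow> real" where
  "best_response d lo hi \<theta> p =
     (THE x. x \<in> {lo..hi} \<and> (\<forall>y\<in>{lo..hi}. \<theta> \<bullet> Phi d x + p * x \<le> \<theta> \<bullet> Phi d y + p * y))"

definition mat_inv :: "real mat \<Rightarrow> real mat" where
  "mat_inv A = (SOME B. B \<in> carrier_mat (dim_row A) (dim_row A) \<and> inverts_mat A B \<and> inverts_mat B A)"

definition mat_trace :: "real mat \<Rightarrow> real" where
  "mat_trace A = (\<Sum>k<dim_row A. A $$ (k,k))"

definition outer :: "real vec \<Rightarrow> real mat" where
  "outer v = mat (dim_vec v) (dim_vec v) (\<lambda>(j,k). v $ j * v $ k)"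

definition pos_def :: "nat \<Rightarrow> real mat \<Rightarrow> bool" where
  "pos_def d S \<longleftrightarrow> S \<in> carrier_mat d d \<and> transpose_mat S = S \<and>
     (\<forall>v\<in>carrier_vec d. v \<noteq> 0\<^sub>v d \<longrightarrow> v \<bullet> (S *\<^sub>v v) > 0)"

definition A_sched :: "real \<Rightarrow> nat \<Rightarrow> real" where
  "A_sched \<gamma> t = (if t = 0 then 0 else real t powr \<gamma> * ln (real t))"

context
  fixes d :: nat and lo hi :: real and \<theta>s :: "real vec"
    and \<Sigma>0 :: "real mat" and \<theta>0 :: "real vec" and xdes :: real and \<gamma> :: real
    and w :: "nat \<Rightarrow> real"   (* probing draws p_i(tau) ~ N(0,sigma^2) *)
    and e :: "nat \<Rightarrow> real"
begin

(* exploration test at time tau (uses Sigma(tau-1), A(tau-1)) *)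
definition explore :: "nat \<Rightarrow> real mat \<Rightarrow> bool" where
  "explore \<tau> S \<longleftrightarrow> A_sched \<gamma> (\<tau> - 1) \<le> 0 \<or> mat_trace S > 1 / A_sched \<gamma> (\<tau> - 1)"

(* price issued at time tau given state (Sigma(tau-1), theta_hat(tau-1)) *)
definition price :: "nat \<Rightarrow> real mat \<times> real vec \<Rightarrow> real" where
  "price \<tau> st = (if explore \<tau> (fst st) then w \<tau> else - (snd st \<bullet> dPhi d xdes))"

fun raid_state :: "nat \<Rightarrow> real mat \<times> real vec" where
  "raid_state 0 = (\<Sigma>0, \<theta>0)"
| "raid_state (Suc \<tau>) =
    (let (S, th) = raid_state \<tau>;
         p = price (Suc \<tau>) (S, th);
         x = best_response d lo hi \<theta>s p;
         \<xi> = dPhi d x;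
         \<delta> = (if lo < x \<and> x < hi then 1 else 0 :: real);
         phat = - (\<theta>s \<bullet> \<xi>) + e (Suc \<tau>)
     in if explore (Suc \<tau>) S then
          (let S' = mat_inv (mat_inv S + \<delta> \<cdot>\<^sub>m outer \<xi>)
           in (S', th - (\<delta> * (phat + \<xi> \<bullet> th)) \<cdot>\<^sub>v (S' *\<^sub>v \<xi>)))
        else (S, th))"

definition raid_theta :: "nat \<Rightarrow> real vec" where
  "raid_theta \<tau> = snd (raid_state \<tau>)"

(* response x_i(tau) for tau \<ge> 1 *)
definition raid_x :: "nat \<Rightarrow> real" where
  "raid_x \<tau> = best_response d lo hi \<theta>s (price \<tau> (raid_state (\<tau> - 1)))"

end

end

theory Submission
  imports Defs "Jordan_Normal_Form.Determinant" "HOL-Real_Asymp.Real_Asymp"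
begin

text \<open>
  Whether a step explores depends only on the information matrix \<open>P = \<Sigma>\<^sup>-\<^sup>1\<close>, hence only on earlier
  probing draws. The trace test forces the number \<open>N\<close> of explorations to be at least of order
  \<open>A(t) = t\<^sup>\<gamma> log t\<close>, because \<open>tr \<Sigma> \<ge> 1 / P\<^sub>0\<^sub>0\<close> and \<open>P\<^sub>0\<^sub>0\<close> grows by at most one per exploration.
  Conversely, a law of large numbers along the exploration times gives \<open>P \<ge> c N\<close>, because the Gaussian
  probes yield a positive definite expected information matrix; so \<open>tr \<Sigma> = O(1/N)\<close> and \<open>N = O(A(t))\<close>.

  The estimation error is \<open>\<Sigma>\<close> applied to a noise sum over the explorations. Both the law of large
  numbers and the bound \<open>O(t\<^bsup>\<gamma>/2\<^esup> log t)\<close> for the noise sum come from one exponential supermartingale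
  for clipped increments, a Chernoff bound at a deterministic scale for each \<open>t\<close>, and Borel--Cantelli;
  the moment of order \<open>a > 2\<close> ensures that eventually no noise term is clipped. Hence the squared error
  is \<open>O(t\<^sup>\<gamma> log\<^sup>2 t / N\<^sup>2) = O(t\<^bsup>-\<gamma>\<^esup>)\<close>. Each exploration costs a bounded regret, and
  exploitation costs at most a multiple of the squared error since the best response is Lipschitz.
\<close>

section \<open>Positive definite matrices\<close>

text \<open>The obstacle is that the number \<open>N\<close> of explorations is random and the noise
  has only slightly more than two moments, while the claimed error rate has no logarithm to spare. A
  random normalisation is avoided: for each \<open>t\<close> the noise sum is tested at the
  deterministic scale \<open>t powr (\<gamma>/2)\<close>. With \<open>N\<close> of order
  \<open>t powr \<gamma> * ln t\<close>, the quadratic compensator at that scale is of order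
  \<open>ln t\<close>, just like the Chernoff level \<open>2 * ln t\<close> that makes the failure
  probabilities summable. The resulting bound exceeds \<open>sqrt N\<close> by a factor of order
  \<open>sqrt (ln t)\<close>, and the logarithm in the schedule pays for it: dividing by
  \<open>N\<close> cancels \<open>ln t\<close> exactly. Clipping is harmless because the noise at
  the k-th exploration is eventually at most \<open>k powr \<beta>\<close> for any \<beta> > 1/a,
  and moments above 2 leave room for \<beta> < 1/2, which keeps it below the scale.\<close>

no_notation inner (infix "\<bullet>" 70)
no_notation vec_nth (infixl "$" 90)

text \<open>\<open>mat_inv\<close> is a Hilbert choice, so computing it rests on uniqueness of the
  inverse; for square matrices a one-sided identity is enough.\<close>

lemma mat_inv_eqI:
  assumes A: "A \<in> carrier_mat n n" and B: "B \<in> carrier_mat n n" and AB: "A * B = 1\<^sub>m n"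
  shows "mat_inv A = B"
proof -
  have BA: "B * A = 1\<^sub>m n" by (rule mat_mult_left_right_inverse[OF A B AB])
  have "C = B" if C: "C \<in> carrier_mat n n" "A * C = 1\<^sub>m n" for C
  proof -
    have "C = 1\<^sub>m n * C" using left_mult_one_mat[OF C(1)] by simp
    also have "\<dots> = B * (A * C)" unfolding BA[symmetric] by (rule assoc_mult_mat[OF B A C(1)])
    also have "\<dots> = B" unfolding C(2) by (rule right_mult_one_mat[OF B])
    finally show ?thesis .
  qed
  note uniq = this
  show ?thesis unfolding mat_inv_def
  proof (rule some_equality)
    show "B \<in> carrier_mat (dim_row A) (dim_row A) \<and> inverts_mat A B \<and> inverts_mat B A"
      using A B AB BA by (simp add: inverts_mat_def)
    fix C assume "C \<in> carrier_mat (dim_row A) (dim_row A) \<and> inverts_mat A C \<and> inverts_mat C A"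
    then show "C = B" using A by (intro uniq) (simp_all add: inverts_mat_def)
  qed
qed

lemma pos_def_det_nonzero:
  assumes "pos_def d S" shows "det S \<noteq> 0"
proof
  assume "det S = 0"
  moreover have S: "S \<in> carrier_mat d d" using assms by (simp add: pos_def_def)
  ultimately obtain v where v: "v \<in> carrier_vec d" "v \<noteq> 0\<^sub>v d" "S *\<^sub>v v = 0\<^sub>v d"
    using det_0_iff_vec_prod_zero_field[OF S] by auto
  then have "v \<bullet> (S *\<^sub>v v) = 0" by simp
  with v assms show False by (auto simp: pos_def_def)
qed

text \<open>The adjugate supplies the existence of an inverse and shows \<open>mat_inv\<close> to be
  rational in the entries, from which measurability follows later.\<close>

lemma mat_inv_adjugate:
  assumes S: "S \<in> carrier_mat d d" and D: "det S \<noteq> 0"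
  shows "mat_inv S = (1 / det S) \<cdot>\<^sub>m adj_mat S"
proof (rule mat_inv_eqI[OF S])
  show "(1 / det S) \<cdot>\<^sub>m adj_mat S \<in> carrier_mat d d" using adj_mat(1)[OF S] by simp
  have "S * ((1 / det S) \<cdot>\<^sub>m adj_mat S) = (1 / det S) \<cdot>\<^sub>m (S * adj_mat S)"
    using S adj_mat(1)[OF S] by (simp add: mult_smult_distrib)
  also have "\<dots> = 1\<^sub>m d" using D by (intro eq_matI) (auto simp: adj_mat(2)[OF S])
  finally show "S * ((1 / det S) \<cdot>\<^sub>m adj_mat S) = 1\<^sub>m d" .
qed

lemma pos_def_inverse:
  assumes "pos_def d S"
  shows "mat_inv S \<in> carrier_mat d d" "S * mat_inv S = 1\<^sub>m d" "mat_inv S * S = 1\<^sub>m d"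
    "mat_inv (mat_inv S) = S"
proof -
  have S: "S \<in> carrier_mat d d" using assms by (simp add: pos_def_def)
  have D: "det S \<noteq> 0" by (rule pos_def_det_nonzero[OF assms])
  show c: "mat_inv S \<in> carrier_mat d d"
    using adj_mat(1)[OF S] by (simp add: mat_inv_adjugate[OF S D])
  have "S * mat_inv S = (1 / det S) \<cdot>\<^sub>m (S * adj_mat S)"
    using S adj_mat(1)[OF S] by (simp add: mat_inv_adjugate[OF S D] mult_smult_distrib)
  also have "\<dots> = 1\<^sub>m d" using D by (intro eq_matI) (auto simp: adj_mat(2)[OF S])
  finally show SI: "S * mat_inv S = 1\<^sub>m d" .
  then show IS: "mat_inv S * S = 1\<^sub>m d" by (rule mat_mult_left_right_inverse[OF S c])
  show "mat_inv (mat_inv S) = S" by (rule mat_inv_eqI[OF c S IS])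
qed

lemma pos_def_mat_inv:
  assumes "pos_def d S" shows "pos_def d (mat_inv S)"
proof -
  have S: "S \<in> carrier_mat d d" and tS: "transpose_mat S = S" using assms by (auto simp: pos_def_def)
  note I = pos_def_inverse[OF assms]
  have "S * transpose_mat (mat_inv S) = transpose_mat (mat_inv S * S)"
    using transpose_mult[OF I(1) S] tS by simp
  also have "\<dots> = 1\<^sub>m d" using I by simp
  finally have "S * transpose_mat (mat_inv S) = 1\<^sub>m d" .
  from mat_inv_eqI[OF S _ this] have tI: "transpose_mat (mat_inv S) = mat_inv S"
    using I(1) by simp
  have "v \<bullet> (mat_inv S *\<^sub>v v) > 0" if v: "v \<in> carrier_vec d" "v \<noteq> 0\<^sub>v d" for v
  proof -
    define u where "u = mat_inv S *\<^sub>v v"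
    have u: "u \<in> carrier_vec d" using I(1) v by (simp add: u_def)
    have Su: "S *\<^sub>v u = v" unfolding u_def using S I(1,2) v by (simp flip: assoc_mult_mat_vec)
    have "u \<noteq> 0\<^sub>v d" using Su S v by auto
    then have "u \<bullet> (S *\<^sub>v u) > 0" using assms u by (auto simp: pos_def_def)
    then show ?thesis using Su u v by (simp add: u_def[symmetric] comm_scalar_prod[OF u v(1)])
  qed
  then show ?thesis using I(1) tI by (auto simp: pos_def_def)
qed

lemma smult_mat_mult_vec:
  "A \<in> carrier_mat nr nc \<Longrightarrow> v \<in> carrier_vec nc \<Longrightarrow> (a \<cdot>\<^sub>m A) *\<^sub>v v = a \<cdot>\<^sub>v (A *\<^sub>v v)"
  for a :: "'a :: comm_semiring_0"
  by (intro eq_vecI) (auto simp: scalar_prod_def sum_distrib_left mult.assoc)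

lemma outer_carrier [simp]: "v \<in> carrier_vec d \<Longrightarrow> outer v \<in> carrier_mat d d"
  by (auto simp: outer_def)

lemma outer_mult_vec:
  assumes "v \<in> carrier_vec d" "u \<in> carrier_vec d"
  shows "outer v *\<^sub>v u = (v \<bullet> u) \<cdot>\<^sub>v v"
  using assms
  by (intro eq_vecI) (auto simp: outer_def scalar_prod_def sum_distrib_left sum_distrib_right ac_simps)

lemma pos_def_add_outer:
  assumes P: "pos_def d P" and v: "v \<in> carrier_vec d" and a: "a \<ge> 0"
  shows "pos_def d (P + a \<cdot>\<^sub>m outer v)"
proof -
  have Pc: "P \<in> carrier_mat d d" and Pt: "transpose_mat P = P" using P by (auto simp: pos_def_def)
  have "transpose_mat (a \<cdot>\<^sub>m outer v) = a \<cdot>\<^sub>m outer v"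
    by (intro eq_matI) (auto simp: outer_def)
  then have "transpose_mat (P + a \<cdot>\<^sub>m outer v) = P + a \<cdot>\<^sub>m outer v"
    using Pc Pt v by (simp add: transpose_add[of _ d d])
  moreover have "u \<bullet> ((P + a \<cdot>\<^sub>m outer v) *\<^sub>v u) > 0" if u: "u \<in> carrier_vec d" "u \<noteq> 0\<^sub>v d" for u
  proof -
    have "(P + a \<cdot>\<^sub>m outer v) *\<^sub>v u = P *\<^sub>v u + (a * (v \<bullet> u)) \<cdot>\<^sub>v v"
      using Pc u v outer_carrier[OF v]
      by (simp add: add_mult_distrib_mat_vec[of _ d d] smult_mat_mult_vec[OF outer_carrier[OF v]] outer_mult_vec[of _ d] smult_smult_assoc)
    then have "u \<bullet> ((P + a \<cdot>\<^sub>m outer v) *\<^sub>v u) = u \<bullet> (P *\<^sub>v u) + a * (v \<bullet> u) * (v \<bullet> u)"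
      using u v Pc by (simp add: scalar_prod_add_distrib[of _ d] comm_scalar_prod[OF u(1) v])
    moreover have "u \<bullet> (P *\<^sub>v u) > 0" using P u by (auto simp: pos_def_def)
    ultimately show ?thesis using a by (simp add: add_pos_nonneg mult.assoc)
  qed
  ultimately show ?thesis using Pc v by (auto simp: pos_def_def)
qed

lemma pos_def_Cauchy_Schwarz:
  assumes P: "pos_def d P" and u: "u \<in> carrier_vec d" and v: "v \<in> carrier_vec d"
  shows "(u \<bullet> (P *\<^sub>v v))\<^sup>2 \<le> (u \<bullet> (P *\<^sub>v u)) * (v \<bullet> (P *\<^sub>v v))"
proof (cases "u = 0\<^sub>v d")
  case True
  moreover have "P *\<^sub>v v \<in> carrier_vec d" "P *\<^sub>v 0\<^sub>v d \<in> carrier_vec d"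
    using P v by (auto simp: pos_def_def)
  ultimately show ?thesis by simp
next
  case False
  have Pc: "P \<in> carrier_mat d d" and Pt: "transpose_mat P = P" using P by (auto simp: pos_def_def)
  define a b c where "a = u \<bullet> (P *\<^sub>v u)" and "b = u \<bullet> (P *\<^sub>v v)" and "c = v \<bullet> (P *\<^sub>v v)"
  have a: "a > 0" using P u False by (auto simp: a_def pos_def_def)
  have sym: "v \<bullet> (P *\<^sub>v u) = b"
    using transpose_vec_mult_scalar[OF Pc u v] Pt Pc u v
    by (simp add: b_def comm_scalar_prod[of u d "P *\<^sub>v v"])
  \<comment> \<open>\<open>z\<close> is what remains of \<open>v\<close> after
    \<open>P\<close>-orthogonal projection onto \<open>u\<close>; the form at \<open>z\<close>
    equals \<open>c - b\<^sup>2 / a\<close>, which cannot be negative.\<close>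
  define z where "z = v + (- b / a) \<cdot>\<^sub>v u"
  have z: "z \<in> carrier_vec d" using u v by (simp add: z_def)
  have "P *\<^sub>v z = P *\<^sub>v v + (- b / a) \<cdot>\<^sub>v (P *\<^sub>v u)"
    unfolding z_def using Pc u v by (simp add: mult_add_distrib_mat_vec[of _ d d] mult_mat_vec[of _ d d])
  then have "z \<bullet> (P *\<^sub>v z) = c - b\<^sup>2 / a"
    unfolding z_def using Pc u v a
    by (simp add: scalar_prod_add_distrib[of _ d] add_scalar_prod_distrib[of _ d] sym
        a_def[symmetric] b_def[symmetric] c_def[symmetric] power2_eq_square field_simps)
  moreover have "z \<bullet> (P *\<^sub>v z) \<ge> 0"
    using P z by (cases "z = 0\<^sub>v d") (auto simp: pos_def_def less_imp_le)
  ultimately have "b\<^sup>2 / a \<le> c" by simp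
  then have "b\<^sup>2 \<le> a * c" using a by (simp add: divide_le_eq mult.commute)
  then show ?thesis by (simp add: a_def b_def c_def)
qed

text \<open>The coordinate \<open>v $ j\<close> is the \<open>P\<close>-inner product of
  \<open>v\<close> with \<open>P\<^sup>-\<^sup>1 e\<^sub>j\<close>, so Cauchy--Schwarz for
  \<open>P\<close> bounds its square; summing over \<open>j\<close> produces the trace. Thus
  \<open>1 / tr P\<^sup>-\<^sup>1\<close>, the quantity seen by the exploration test, serves as a
  lower bound for the least eigenvalue.\<close>

lemma sq_norm_le_trace_inverse:
  assumes P: "pos_def d P" and v: "v \<in> carrier_vec d"
  shows "v \<bullet> v \<le> mat_trace (mat_inv P) * (v \<bullet> (P *\<^sub>v v))"
proof -
  note I = pos_def_inverse[OF P]
  have Pc: "P \<in> carrier_mat d d" using P by (auto simp: pos_def_def)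
  have Pt: "transpose_mat P = P" using P by (auto simp: pos_def_def)
  have "(v $ j)\<^sup>2 \<le> mat_inv P $$ (j,j) * (v \<bullet> (P *\<^sub>v v))" if j: "j < d" for j
  proof -
    define u where "u = mat_inv P *\<^sub>v unit_vec d j"
    have u: "u \<in> carrier_vec d" using I(1) by (simp add: u_def)
    have Pu: "P *\<^sub>v u = unit_vec d j"
      unfolding u_def using Pc I(1,2) by (simp flip: assoc_mult_mat_vec)
    have uj: "u $ j = mat_inv P $$ (j,j)" using I(1) j by (simp add: u_def)
    have "u \<bullet> (P *\<^sub>v v) = v $ j"
      using transpose_vec_mult_scalar[OF Pc v u] Pt Pc u v Pu j by simp
    moreover have "u \<bullet> (P *\<^sub>v u) = mat_inv P $$ (j,j)" using Pu u j uj by simp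
    ultimately show ?thesis using pos_def_Cauchy_Schwarz[OF P u v] by simp
  qed
  then have "(\<Sum>j<d. (v $ j)\<^sup>2) \<le> (\<Sum>j<d. mat_inv P $$ (j,j) * (v \<bullet> (P *\<^sub>v v)))"
    by (intro sum_mono) auto
  then show ?thesis using v I(1)
    by (simp add: scalar_prod_def mat_trace_def sum_distrib_right power2_eq_square atLeast0LessThan)
qed

text \<open>For the \<open>j\<close>-th column \<open>u\<close> of the inverse, the hypothesis reads
  \<open>c * (u $ j)\<^sup>2 \<le> c * (u \<bullet> u) \<le> u $ j\<close>, which forces the
  diagonal entry below \<open>1 / c\<close>.\<close>

lemma trace_inverse_le:
  assumes P: "pos_def d P" and c: "c > 0"
    and lower: "\<And>v. v \<in> carrier_vec d \<Longrightarrow> c * (v \<bullet> v) \<le> v \<bullet> (P *\<^sub>v v)"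
  shows "mat_trace (mat_inv P) \<le> real d / c"
proof -
  note I = pos_def_inverse[OF P]
  have Pc: "P \<in> carrier_mat d d" using P by (auto simp: pos_def_def)
  have "mat_inv P $$ (j,j) \<le> 1 / c" if j: "j < d" for j
  proof -
    define u where "u = mat_inv P *\<^sub>v unit_vec d j"
    have u: "u \<in> carrier_vec d" using I(1) by (simp add: u_def)
    have Pu: "P *\<^sub>v u = unit_vec d j"
      unfolding u_def using Pc I(1,2) by (simp flip: assoc_mult_mat_vec)
    have uj: "u $ j = mat_inv P $$ (j,j)" using I(1) j by (simp add: u_def)
    have "(u $ j)\<^sup>2 \<le> (\<Sum>k<d. (u $ k)\<^sup>2)" using j by (intro member_le_sum) auto
    also have "\<dots> = u \<bullet> u" using u by (simp add: scalar_prod_def power2_eq_square atLeast0LessThan)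
    finally have "c * (u $ j)\<^sup>2 \<le> c * (u \<bullet> u)" using c by simp
    also have "\<dots> \<le> u $ j" using lower[OF u] Pu u j by simp
    finally have "c * (u $ j)\<^sup>2 \<le> u $ j" .
    then have "c * u $ j \<le> 1"
    proof (cases "u $ j \<le> 0")
      case True
      then have "c * u $ j \<le> 0" using c by (simp add: mult_le_0_iff)
      then show ?thesis by simp
    next
      case False
      then show ?thesis using \<open>c * (u $ j)\<^sup>2 \<le> u $ j\<close> by (simp add: power2_eq_square)
    qed
    then show ?thesis using c uj by (simp add: field_simps)
  qed
  then have "(\<Sum>j<d. mat_inv P $$ (j,j)) \<le> (\<Sum>j<d. 1 / c)" by (intro sum_mono) auto
  then show ?thesis using I(1) by (simp add: mat_trace_def)
qed

lemma quad_unit_vec: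
  fixes A :: "real mat"
  assumes "A \<in> carrier_mat d d" "j < d"
  shows "unit_vec d j \<bullet> (A *\<^sub>v unit_vec d j) = A $$ (j,j)"
proof -
  have "A *\<^sub>v unit_vec d j \<in> carrier_vec d" using assms by simp
  from scalar_prod_left_unit[OF this assms(2)] show ?thesis using assms by simp
qed

lemma quad_sum:
  fixes A :: "real mat"
  assumes "A \<in> carrier_mat d d" "v \<in> carrier_vec d"
  shows "v \<bullet> (A *\<^sub>v v) = (\<Sum>j<d. \<Sum>k<d. v $ j * v $ k * A $$ (j,k))"
  using assms
  by (auto simp: scalar_prod_def atLeast0LessThan sum_distrib_left mult_ac intro!: sum.cong)

lemma scalar_prod_Cauchy_Schwarz:
  fixes u v :: "real vec"
  assumes "u \<in> carrier_vec n" "v \<in> carrier_vec n"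
  shows "(u \<bullet> v)\<^sup>2 \<le> (u \<bullet> u) * (v \<bullet> v)"
  using Cauchy_Schwarz_ineq_sum[of "\<lambda>i. u $ i" "\<lambda>i. v $ i" "{0..<n}"] assms
  by (simp add: scalar_prod_def power2_eq_square)

lemma scalar_prod_self_nonneg: "0 \<le> (v :: real vec) \<bullet> v"
  unfolding scalar_prod_def by (intro sum_nonneg) simp

section \<open>Measurability of determinants and of the trace of an inverse\<close>

lemma borel_measurable_det:
  assumes A: "\<And>x. x \<in> space N \<Longrightarrow> A x \<in> carrier_mat n n"
    and m: "\<And>i j. i < n \<Longrightarrow> j < n \<Longrightarrow> (\<lambda>x. A x $$ (i,j)) \<in> borel_measurable N"
  shows "(\<lambda>x. det (A x) :: real) \<in> borel_measurable N"
proof -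
  have "p i < n" if "p permutes {0..<n}" "i < n" for p i
    using permutes_in_image[OF that(1), of i] that(2) by simp
  then have "(\<lambda>x. \<Sum>p | p permutes {0..<n}. signof p * (\<Prod>i = 0..<n. A x $$ (i, p i))) \<in> borel_measurable N"
    by (intro borel_measurable_sum borel_measurable_times borel_measurable_prod borel_measurable_const m)
      auto
  moreover have "(\<lambda>x. det (A x)) \<in> borel_measurable N \<longleftrightarrow>
      (\<lambda>x. \<Sum>p | p permutes {0..<n}. signof p * (\<Prod>i = 0..<n. A x $$ (i, p i))) \<in> borel_measurable N"
    by (rule measurable_cong) (rule det_def'[OF A])
  ultimately show ?thesis by simp
qed

text \<open>The exploration test compares this trace with the schedule, so its measurability makes
  the exploration indicators random variables. Cofactors reduce it to determinants.\<close>

lemma borel_measurable_trace_inverse: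
  assumes A: "\<And>x. x \<in> space N \<Longrightarrow> pos_def n (A x)"
    and m: "\<And>i j. i < n \<Longrightarrow> j < n \<Longrightarrow> (\<lambda>x. A x $$ (i,j)) \<in> borel_measurable N"
  shows "(\<lambda>x. mat_trace (mat_inv (A x))) \<in> borel_measurable N"
proof -
  have c: "A x \<in> carrier_mat n n" if "x \<in> space N" for x using A[OF that] by (simp add: pos_def_def)
  have eq: "mat_trace (mat_inv (A x)) = (\<Sum>k<n. (1 / det (A x)) * cofactor (A x) k k)"
    if x: "x \<in> space N" for x
  proof -
    have "dim_row (A x) = n" "dim_col (A x) = n" using c[OF x] by auto
    then show ?thesis
      unfolding mat_inv_adjugate[OF c[OF x] pos_def_det_nonzero[OF A[OF x]]] mat_trace_def adj_mat_def
      by (intro sum.cong) auto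
  qed
  have cof: "(\<lambda>x. cofactor (A x) k k) \<in> borel_measurable N" if k: "k < n" for k
  proof -
    have "(\<lambda>x. det (mat_delete (A x) k k)) \<in> borel_measurable N"
    proof (rule borel_measurable_det[of _ _ "n - 1"])
      show "mat_delete (A x) k k \<in> carrier_mat (n - 1) (n - 1)" if "x \<in> space N" for x
        using mat_delete_carrier[OF c[OF that]] .
      fix i j assume ij: "i < n - 1" "j < n - 1"
      have "(\<lambda>x. A x $$ (if i < k then i else Suc i, if j < k then j else Suc j)) \<in> borel_measurable N"
        using ij by (intro m) auto
      moreover have "mat_delete (A x) k k $$ (i, j) = A x $$ (if i < k then i else Suc i, if j < k then j else Suc j)"
        if "x \<in> space N" for x
        using ij c[OF that] by (auto simp: mat_delete_def)
      ultimately show "(\<lambda>x. mat_delete (A x) k k $$ (i, j)) \<in> borel_measurable N"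
        using measurable_cong[of N "\<lambda>x. mat_delete (A x) k k $$ (i, j)"
            "\<lambda>x. A x $$ (if i < k then i else Suc i, if j < k then j else Suc j)" borel] by blast
    qed
    then show ?thesis by (simp add: cofactor_def)
  qed
  have "(\<lambda>x. \<Sum>k<n. (1 / det (A x)) * cofactor (A x) k k) \<in> borel_measurable N"
    by (intro borel_measurable_sum borel_measurable_times borel_measurable_divide
        borel_measurable_const borel_measurable_det[OF c m] cof) auto
  moreover have "(\<lambda>x. mat_trace (mat_inv (A x))) \<in> borel_measurable N \<longleftrightarrow>
      (\<lambda>x. \<Sum>k<n. (1 / det (A x)) * cofactor (A x) k k) \<in> borel_measurable N"
    by (rule measurable_cong) (rule eq)
  ultimately show ?thesis by simp
qed

section \<open>The best response\<close>

locale agent =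
  fixes d :: nat and lo hi m Mx :: real and \<theta>s :: "real vec"
  assumes lo_less_hi: "lo < hi" and m_pos: "0 < m" and theta_in: "\<theta>s \<in> Theta d lo hi m Mx"
begin

definition grad :: "real \<Rightarrow> real" where "grad x = \<theta>s \<bullet> dPhi d x"

abbreviation br :: "real \<Rightarrow> real" where "br \<equiv> best_response d lo hi \<theta>s"

lemma theta_carrier: "\<theta>s \<in> carrier_vec d"
  using theta_in by (simp add: Theta_def)

lemma dPhi_carrier [simp]: "dPhi d x \<in> carrier_vec d"
  by (simp add: dPhi_def)

lemma DERIV_cost: "((\<lambda>x. \<theta>s \<bullet> Phi d x) has_real_derivative grad x) (at x)"
proof -
  have "((\<lambda>x. \<Sum>k=0..<d. \<theta>s $ k * x ^ (k+1)) has_real_derivative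
      (\<Sum>k=0..<d. \<theta>s $ k * (real (k+1) * x ^ k))) (at x)"
    using DERIV_pow[of "_ + 1"] by (intro DERIV_sum DERIV_cmult) auto
  then show ?thesis by (simp add: grad_def Phi_def dPhi_def scalar_prod_def)
qed

lemma DERIV_grad: "(grad has_real_derivative \<theta>s \<bullet> d2Phi d x) (at x)"
proof -
  have "((\<lambda>x. \<Sum>k=0..<d. \<theta>s $ k * (real (k+1) * x ^ k)) has_real_derivative
      (\<Sum>k=0..<d. \<theta>s $ k * (real (k+1) * real k * x ^ (k-1)))) (at x)"
    by (auto intro!: derivative_eq_intros sum.cong)
  moreover have "grad = (\<lambda>x. \<Sum>k=0..<d. \<theta>s $ k * (real (k+1) * x ^ k))"
    by (auto simp: grad_def dPhi_def scalar_prod_def)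
  ultimately show ?thesis by (simp add: d2Phi_def scalar_prod_def)
qed

lemma grad_strongly_mono:
  assumes "lo \<le> x" "x \<le> y" "y \<le> hi"
  shows "m * (y - x) \<le> grad y - grad x"
proof -
  have "grad x - m * x \<le> grad y - m * y"
  proof (rule DERIV_nonneg_imp_nondecreasing[OF assms(2)])
    fix z assume z: "x \<le> z" "z \<le> y"
    have "((\<lambda>x. grad x - m * x) has_real_derivative \<theta>s \<bullet> d2Phi d z - m) (at z)"
      by (auto intro!: derivative_eq_intros DERIV_grad)
    moreover have "\<theta>s \<bullet> d2Phi d z - m \<ge> 0"
      using theta_in assms z by (auto simp: Theta_def)
    ultimately show "\<exists>y. ((\<lambda>x. grad x - m * x) has_real_derivative y) (at z) \<and> 0 \<le> y" by blast
  qed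
  then show ?thesis by (simp add: algebra_simps)
qed

lemma grad_strict_mono:
  assumes "lo \<le> x" "x < y" "y \<le> hi" shows "grad x < grad y"
  using grad_strongly_mono[of x y] assms m_pos mult_pos_pos[of m "y - x"] by linarith

text \<open>The first-order variational inequality on the interval: one condition covers interior
  minimisers and both endpoints.\<close>

definition stationary :: "real \<Rightarrow> real \<Rightarrow> bool" where
  "stationary p x \<longleftrightarrow> x \<in> {lo..hi} \<and> (\<forall>y\<in>{lo..hi}. (grad x + p) * (y - x) \<ge> 0)"

text \<open>The mean value theorem writes the cost difference as
  \<open>(y - x) * (grad z + p)\<close> with \<open>z\<close> strictly between, and strict
  monotonicity of \<open>grad\<close> lifts this above the nonnegative
  \<open>(y - x) * (grad x + p)\<close>. Strictness is what makes the definite description in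
  \<open>best_response\<close> denote.\<close>

lemma stationary_strict_min:
  assumes x: "stationary p x" and y: "y \<in> {lo..hi}" "y \<noteq> x"
  shows "\<theta>s \<bullet> Phi d x + p * x < \<theta>s \<bullet> Phi d y + p * y"
proof -
  define F where "F z = \<theta>s \<bullet> Phi d z + p * z" for z
  have D: "(F has_real_derivative grad z + p) (at z)" for z
    unfolding F_def by (auto intro!: derivative_eq_intros DERIV_cost)
  have xi: "lo \<le> x" "x \<le> hi" and vi: "(grad x + p) * (y - x) \<ge> 0"
    using x y by (auto simp: stationary_def)
  have "F x < F y"
  proof (cases "x < y")
    case True
    obtain z where z: "x < z" "z < y" "F y - F x = (y - x) * (grad z + p)"
      using MVT2[OF True, of F "\<lambda>z. grad z + p"] D by blast
    have "grad x < grad z" using z xi y by (intro grad_strict_mono) auto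
    then have "(y - x) * (grad x + p) < (y - x) * (grad z + p)" using True by simp
    then have "0 < F y - F x" using z(3) vi by (simp add: mult.commute)
    then show ?thesis by simp
  next
    case False
    then have yx: "y < x" using y by simp
    obtain z where z: "y < z" "z < x" "F x - F y = (x - y) * (grad z + p)"
      using MVT2[OF yx, of F "\<lambda>z. grad z + p"] D by blast
    have "grad z < grad x" using z xi y by (intro grad_strict_mono) auto
    then have "(x - y) * (grad z + p) < (x - y) * (grad x + p)" using yx by simp
    then show ?thesis using z vi by (simp add: algebra_simps)
  qed
  then show ?thesis by (simp add: F_def)
qed

lemma br_eqI:
  assumes "stationary p x" shows "br p = x"
  unfolding best_response_def
proof (rule the_equality)
  show "x \<in> {lo..hi} \<and> (\<forall>y\<in>{lo..hi}. \<theta>s \<bullet> Phi d x + p * x \<le> \<theta>s \<bullet> Phi d y + p * y)"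
    using stationary_strict_min[OF assms] assms by (force simp: stationary_def)
next
  fix z assume z: "z \<in> {lo..hi} \<and> (\<forall>y\<in>{lo..hi}. \<theta>s \<bullet> Phi d z + p * z \<le> \<theta>s \<bullet> Phi d y + p * y)"
  show "z = x"
  proof (rule ccontr)
    assume "z \<noteq> x"
    then have "\<theta>s \<bullet> Phi d x + p * x < \<theta>s \<bullet> Phi d z + p * z"
      using stationary_strict_min[OF assms] z by blast
    moreover have "x \<in> {lo..hi}" using assms by (simp add: stationary_def)
    ultimately show False using z by fastforce
  qed
qed

lemma stationary_br: "stationary p (br p)"
proof -
  have "\<exists>x. stationary p x"
  proof -
    consider "grad lo + p \<ge> 0" | "grad hi + p \<le> 0" | "grad lo \<le> - p" "- p \<le> grad hi" by linarith
    then show ?thesis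
    proof cases
      case 1 then show ?thesis using lo_less_hi by (intro exI[of _ lo]) (auto simp: stationary_def)
    next
      case 2 then show ?thesis using lo_less_hi
        by (intro exI[of _ hi]) (auto simp: stationary_def mult_nonpos_nonpos)
    next
      case 3
      have "\<exists>x\<ge>lo. x \<le> hi \<and> grad x = - p"
        using lo_less_hi DERIV_isCont[OF DERIV_grad] by (intro IVT) (use 3 in auto)
      then obtain x where "lo \<le> x" "x \<le> hi" "grad x = - p" by auto
      then show ?thesis by (intro exI[of _ x]) (auto simp: stationary_def)
    qed
  qed
  then show ?thesis using br_eqI by metis
qed

lemma br_in: "br p \<in> {lo..hi}"
  using stationary_br by (simp add: stationary_def)

lemma br_eq_of_grad: "lo \<le> x \<Longrightarrow> x \<le> hi \<Longrightarrow> grad x = - p \<Longrightarrow> br p = x"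
  by (intro br_eqI) (simp add: stationary_def)

lemma grad_br_interior:
  assumes "lo < br p" "br p < hi" shows "grad (br p) = - p"
proof -
  have "(grad (br p) + p) * (lo - br p) \<ge> 0" "(grad (br p) + p) * (hi - br p) \<ge> 0"
    using stationary_br[of p] lo_less_hi by (auto simp: stationary_def)
  then show ?thesis using assms by (auto simp: zero_le_mult_iff)
qed

text \<open>If \<open>br p < br q\<close>, the two variational inequalities, each tested at the
  other response, give \<open>grad (br p) \<ge> - p\<close> and
  \<open>grad (br q) \<le> - q\<close>; strong monotonicity turns this gap of gradients into a gap
  of responses. Responses at the endpoints are covered by the same argument.\<close>

lemma br_Lipschitz: "\<bar>br p - br q\<bar> \<le> \<bar>p - q\<bar> / m"
proof -
  have aux: "\<bar>br p - br q\<bar> \<le> \<bar>p - q\<bar> / m" if le: "br p \<le> br q" for p q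
  proof (cases "br p = br q")
    case True then show ?thesis using m_pos by simp
  next
    case False
    have "(grad (br p) + p) * (br q - br p) \<ge> 0" "(grad (br q) + q) * (br p - br q) \<ge> 0"
      using stationary_br[of p] stationary_br[of q] by (auto simp: stationary_def)
    then have "grad (br p) + p \<ge> 0" "grad (br q) + q \<le> 0"
      using le False by (auto simp: zero_le_mult_iff)
    moreover have "m * (br q - br p) \<le> grad (br q) - grad (br p)"
      using br_in[of p] br_in[of q] le by (intro grad_strongly_mono) auto
    ultimately have "m * (br q - br p) \<le> \<bar>p - q\<bar>" by linarith
    then show ?thesis using m_pos le by (simp add: field_simps)
  qed
  show ?thesis
    using aux[of p q] aux[of q p] by (cases "br p \<le> br q") (auto simp: abs_minus_commute)
qed

lemma continuous_br: "continuous_on UNIV br"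
proof (rule lipschitz_on_continuous_on)
  show "(1 / m)-lipschitz_on UNIV br"
    using br_Lipschitz m_pos by (intro lipschitz_onI) (auto simp: dist_real_def)
qed

lemma borel_measurable_br [measurable]: "br \<in> borel_measurable borel"
  by (rule borel_measurable_continuous_onI[OF continuous_br])

text \<open>The prices with an interior response form a nonempty open interval, so that Gaussian
  probes reach it with positive probability; \<open>pos_def_fisher\<close> rests on this.\<close>

lemma br_interior_iff: "lo < br p \<and> br p < hi \<longleftrightarrow> grad lo < - p \<and> - p < grad hi"
proof
  assume *: "lo < br p \<and> br p < hi"
  then show "grad lo < - p \<and> - p < grad hi"
    using grad_br_interior[of p] grad_strict_mono[of lo "br p"] grad_strict_mono[of "br p" hi] by auto
next
  assume *: "grad lo < - p \<and> - p < grad hi"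
  then have "\<exists>x\<ge>lo. x \<le> hi \<and> grad x = - p"
    using lo_less_hi DERIV_isCont[OF DERIV_grad] by (intro IVT) auto
  then obtain x where x: "lo \<le> x" "x \<le> hi" "grad x = - p" by auto
  then have "br p = x" by (intro br_eq_of_grad)
  moreover have "x \<noteq> lo" "x \<noteq> hi" using * x by auto
  ultimately show "lo < br p \<and> br p < hi" using x by auto
qed

end

section \<open>Exponential bounds for clipped sums of innovations\<close>

text \<open>Bounded by 1, so exponential moments exist although the noise has only power moments.
  Since \<open>clip\<close> is odd, replacing \<open>c\<close> by \<open>- c\<close> turns one-sided
  bounds into two-sided ones.\<close>

definition clip :: "real \<Rightarrow> real" where "clip x = (if \<bar>x\<bar> \<le> 1 then x else 0)"

lemma borel_measurable_clip [measurable]: "clip \<in> borel_measurable borel"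
  unfolding clip_def by measurable

lemma exp_le_quadratic:
  fixes y :: real assumes "\<bar>y\<bar> \<le> 1" shows "exp y \<le> 1 + y + y\<^sup>2"
proof (cases "y \<ge> 0")
  case True then show ?thesis using exp_bound[of y] assms by simp
next
  case False
  define u where "u = - y"
  have u: "0 < u" "u \<le> 1" using False assms by (auto simp: u_def)
  have "exp (- u) = 1 / exp u" by (simp add: exp_minus divide_inverse)
  also have "\<dots> \<le> 1 / (1 + u)" using u exp_ge_add_one_self[of u] by (intro divide_left_mono) auto
  also have "\<dots> \<le> 1 - u + u\<^sup>2"
  proof -
    have "(1 - u + u\<^sup>2) * (1 + u) = 1 + u ^ 3" by (simp add: algebra_simps power2_eq_square power3_eq_cube)
    then show ?thesis using u by (simp add: divide_le_eq)
  qed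
  finally show ?thesis by (simp add: u_def)
qed

text \<open>The mean shift caused by clipping is of second order, so clipped centred variables need not be
  re-centred.\<close>
lemma exp_clip_le: "exp (clip x) \<le> 1 + x + 2 * x\<^sup>2"
proof (cases "\<bar>x\<bar> \<le> 1")
  case True
  then have "exp x \<le> 1 + x + x\<^sup>2" by (rule exp_le_quadratic)
  also have "\<dots> \<le> 1 + x + 2 * x\<^sup>2" by simp
  finally show ?thesis using True by (simp add: clip_def)
next
  case False
  have "\<bar>x\<bar> * 1 \<le> \<bar>x\<bar> * \<bar>x\<bar>" using False by (intro mult_left_mono) auto
  then have "- x \<le> x\<^sup>2" by (simp add: power2_eq_square)
  moreover have "0 \<le> x\<^sup>2" by simp
  ultimately have "0 \<le> x + 2 * x\<^sup>2" by linarith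
  then show ?thesis using False by (simp add: clip_def)
qed

section \<open>Exponential moments and independence from a history\<close>

context prob_space
begin

text \<open>A sub-Gaussian type bound from the variance alone: the linear term of
  \<open>exp_clip_le\<close> has mean zero and the quadratic one is at most
  \<open>2 * v * c\<^sup>2\<close>.\<close>

lemma nn_integral_exp_clip_le:
  assumes Y: "integrable M Y" "expectation Y = 0"
    and Y2: "integrable M (\<lambda>\<omega>. (Y \<omega>)\<^sup>2)" "expectation (\<lambda>\<omega>. (Y \<omega>)\<^sup>2) \<le> v"
  shows "(\<integral>\<^sup>+\<omega>. ennreal (exp (clip (c * Y \<omega>))) \<partial>M) \<le> ennreal (exp (2 * v * c\<^sup>2))"
proof -
  have nn: "0 \<le> 1 + c * Y \<omega> + 2 * (c * Y \<omega>)\<^sup>2" for \<omega>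
    using exp_clip_le[of "c * Y \<omega>"] exp_ge_zero[of "clip (c * Y \<omega>)"] by linarith
  have int: "integrable M (\<lambda>\<omega>. 1 + c * Y \<omega> + 2 * (c * Y \<omega>)\<^sup>2)"
    using Y Y2 by (simp add: power_mult_distrib)
  have "(\<integral>\<^sup>+\<omega>. ennreal (exp (clip (c * Y \<omega>))) \<partial>M) \<le> (\<integral>\<^sup>+\<omega>. ennreal (1 + c * Y \<omega> + 2 * (c * Y \<omega>)\<^sup>2) \<partial>M)"
    by (intro nn_integral_mono ennreal_leI exp_clip_le)
  also have "\<dots> = ennreal (expectation (\<lambda>\<omega>. 1 + c * Y \<omega> + 2 * (c * Y \<omega>)\<^sup>2))"
    using int nn by (intro nn_integral_eq_integral) auto
  also have "expectation (\<lambda>\<omega>. 1 + c * Y \<omega> + 2 * (c * Y \<omega>)\<^sup>2) = 1 + 2 * c\<^sup>2 * expectation (\<lambda>\<omega>. (Y \<omega>)\<^sup>2)"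
    using Y Y2 by (simp add: power_mult_distrib prob_space)
  also have "ennreal \<dots> \<le> ennreal (1 + 2 * v * c\<^sup>2)"
    using Y2(2) mult_left_mono[OF Y2(2), of "2 * c\<^sup>2"] by (intro ennreal_leI) (simp add: mult_ac)
  also have "\<dots> \<le> ennreal (exp (2 * v * c\<^sup>2))"
    by (intro ennreal_leI) (rule exp_ge_add_one_self)
  finally show ?thesis .
qed

text \<open>Independence of a random variable from a sub-\<open>\<sigma>\<close>-algebra, which the homogeneous typing of
  \<^const>\<open>indep_var\<close> cannot express directly.\<close>
definition indep_of :: "'a measure \<Rightarrow> ('a \<Rightarrow> real) \<Rightarrow> bool" where
  "indep_of G Y \<longleftrightarrow> (\<lambda>\<omega>. \<omega>) \<in> measurable M G \<and> Y \<in> borel_measurable M \<and>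
     distr M G (\<lambda>\<omega>. \<omega>) \<Otimes>\<^sub>M distr M borel Y = distr M (G \<Otimes>\<^sub>M borel) (\<lambda>\<omega>. (\<omega>, Y \<omega>))"

text \<open>Freezing: \<open>Y\<close> is integrated with the \<open>G\<close>-measurable argument
  held fixed. This form of Fubini plays the role of conditional expectation in the sequel.\<close>

lemma nn_integral_indep_pair:
  assumes ind: "indep_of G Y"
    and f: "f \<in> borel_measurable (G \<Otimes>\<^sub>M borel)"
  shows "(\<integral>\<^sup>+\<omega>. f (\<omega>, Y \<omega>) \<partial>M) = (\<integral>\<^sup>+\<omega>. (\<integral>\<^sup>+\<omega>'. f (\<omega>, Y \<omega>') \<partial>M) \<partial>M)"
proof -
  have id: "(\<lambda>\<omega>. \<omega>) \<in> measurable M G" and Y: "Y \<in> borel_measurable M"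
    and prod: "distr M G (\<lambda>\<omega>. \<omega>) \<Otimes>\<^sub>M distr M borel Y = distr M (G \<Otimes>\<^sub>M borel) (\<lambda>\<omega>. (\<omega>, Y \<omega>))"
    using ind unfolding indep_of_def by auto
  interpret DY: prob_space "distr M borel Y" by (rule prob_space_distr[OF Y])
  have f': "f \<in> borel_measurable (distr M G (\<lambda>\<omega>. \<omega>) \<Otimes>\<^sub>M distr M borel Y)"
    using f by (simp cong: measurable_cong_sets sets_pair_measure_cong)
  have "(\<integral>\<^sup>+\<omega>. f (\<omega>, Y \<omega>) \<partial>M) = (\<integral>\<^sup>+p. f p \<partial>distr M (G \<Otimes>\<^sub>M borel) (\<lambda>\<omega>. (\<omega>, Y \<omega>)))"
    using f id Y by (subst nn_integral_distr) auto
  also have "\<dots> = (\<integral>\<^sup>+\<omega>. (\<integral>\<^sup>+y. f (\<omega>, y) \<partial>distr M borel Y) \<partial>distr M G (\<lambda>\<omega>. \<omega>))"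
    unfolding prod[symmetric] by (rule DY.nn_integral_fst[OF f', symmetric])
  also have "\<dots> = (\<integral>\<^sup>+\<omega>. (\<integral>\<^sup>+y. f (\<omega>, y) \<partial>distr M borel Y) \<partial>M)"
    by (rule nn_integral_distr[OF id DY.borel_measurable_nn_integral_fst[OF f']])
  also have "\<dots> = (\<integral>\<^sup>+\<omega>. (\<integral>\<^sup>+\<omega>'. f (\<omega>, Y \<omega>') \<partial>M) \<partial>M)"
  proof (rule nn_integral_cong)
    fix \<omega> assume "\<omega> \<in> space M"
    then have "\<omega> \<in> space G" using id by (auto simp: measurable_def)
    then have "(\<lambda>y. f (\<omega>, y)) \<in> borel_measurable borel" using f by measurable
    then show "(\<integral>\<^sup>+y. f (\<omega>, y) \<partial>distr M borel Y) = (\<integral>\<^sup>+\<omega>'. f (\<omega>, Y \<omega>') \<partial>M)"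
      using Y by (intro nn_integral_distr) auto
  qed
  finally show ?thesis .
qed

text \<open>The sigma-algebra generated by the \<open>X i\<close> with \<open>i\<close> in
  \<open>A\<close>. Pulling it back from the product space turns each of its events into an event
  about the restricted family, to which independence of disjoint families applies.\<close>

definition hist :: "('i \<Rightarrow> 'a \<Rightarrow> real) \<Rightarrow> 'i set \<Rightarrow> 'a measure" where
  "hist X A = vimage_algebra (space M) (\<lambda>\<omega>. \<lambda>i\<in>A. X i \<omega>) (PiM A (\<lambda>_. borel))"

lemma space_hist [simp]: "space (hist X A) = space M"
  by (simp add: hist_def)

lemma measurable_hist_component:
  assumes "k \<in> A" shows "X k \<in> borel_measurable (hist X A)"
proof -
  have "(\<lambda>\<omega>. \<lambda>i\<in>A. X i \<omega>) \<in> measurable (hist X A) (PiM A (\<lambda>_. borel))"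
    unfolding hist_def by (rule measurable_vimage_algebra1) (auto simp: space_PiM)
  from measurable_compose[OF this measurable_component_singleton[OF assms]]
  show ?thesis using assms by simp
qed

lemma measurable_to_hist:
  assumes "space N = space M" and "\<And>k. k \<in> A \<Longrightarrow> X k \<in> borel_measurable N"
  shows "(\<lambda>\<omega>. \<omega>) \<in> measurable N (hist X A)"
  unfolding hist_def
  using assms by (intro measurable_vimage_algebra2 measurable_restrict) auto

lemma sets_hist_mono:
  assumes "A \<subseteq> B" shows "sets (hist X A) \<subseteq> sets (hist X B)"
proof
  fix S assume S: "S \<in> sets (hist X A)"
  have "(\<lambda>\<omega>. \<omega>) \<in> measurable (hist X B) (hist X A)"
    using assms by (intro measurable_to_hist measurable_hist_component) auto
  from measurable_sets[OF this S] show "S \<in> sets (hist X B)"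
    using sets.sets_into_space[OF S] by (simp add: Int_absorb2)
qed

text \<open>The product measure is determined by rectangles \<open>S \<times> B\<close>, and on a
  rectangle the claim is independence of the subfamilies indexed by \<open>A\<close> and
  \<open>{k}\<close>.\<close>

lemma indep_of_hist:
  assumes ind: "indep_vars (\<lambda>_. borel) X UNIV" and k: "k \<notin> A"
    and \<phi>[measurable]: "\<phi> \<in> borel_measurable borel"
  shows "indep_of (hist X A) (\<lambda>\<omega>. \<phi> (X k \<omega>) :: real)"
proof -
  let ?H = "\<lambda>\<omega>. \<lambda>i\<in>A. X i \<omega>" and ?K = "\<lambda>\<omega>. \<lambda>i\<in>{k}. X i \<omega>" and ?Y = "\<lambda>\<omega>. \<phi> (X k \<omega>)"
  have X[measurable]: "X i \<in> borel_measurable M" for i using ind by (auto simp: indep_vars_def)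
  have id: "(\<lambda>\<omega>. \<omega>) \<in> measurable M (hist X A)" by (intro measurable_to_hist X) auto
  have I: "indep_var (PiM A (\<lambda>_. borel)) ?H (PiM {k} (\<lambda>_. borel)) ?K"
    using indep_var_restrict[OF ind, of A "{k}"] k by auto
  interpret D1: prob_space "distr M (hist X A) (\<lambda>\<omega>. \<omega>)" by (rule prob_space_distr[OF id])
  interpret D2: prob_space "distr M borel ?Y" by (rule prob_space_distr) measurable
  have pair: "(\<lambda>\<omega>. (\<omega>, ?Y \<omega>)) \<in> measurable M (hist X A \<Otimes>\<^sub>M borel)"
    using id by measurable
  have "distr M (hist X A) (\<lambda>\<omega>. \<omega>) \<Otimes>\<^sub>M distr M borel ?Y = distr M (hist X A \<Otimes>\<^sub>M borel) (\<lambda>\<omega>. (\<omega>, ?Y \<omega>))"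
  proof (rule pair_measure_eqI)
    show "sets (distr M (hist X A) (\<lambda>\<omega>. \<omega>) \<Otimes>\<^sub>M distr M borel ?Y) =
        sets (distr M (hist X A \<Otimes>\<^sub>M borel) (\<lambda>\<omega>. (\<omega>, ?Y \<omega>)))"
      by (simp cong: sets_pair_measure_cong)
    fix S B assume "S \<in> sets (distr M (hist X A) (\<lambda>\<omega>. \<omega>))" "B \<in> sets (distr M borel ?Y)"
    then have S: "S \<in> sets (hist X A)" and B[measurable]: "B \<in> sets borel" by auto
    obtain S' where S': "S' \<in> sets (PiM A (\<lambda>_. borel))" "S = ?H -` S' \<inter> space M"
      using S unfolding hist_def by (subst (asm) sets_vimage_algebra2) (auto simp: space_PiM)
    define B' where "B' = (\<lambda>h. h k) -` (\<phi> -` B) \<inter> space (PiM {k} (\<lambda>_. borel :: real measure))"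
    have "(\<lambda>h. \<phi> (h k)) \<in> borel_measurable (PiM {k} (\<lambda>_. borel :: real measure))" by measurable
    from measurable_sets[OF this B] have B': "B' \<in> sets (PiM {k} (\<lambda>_. borel))"
      by (simp add: B'_def vimage_def)
    have KB: "?K -` B' \<inter> space M = ?Y -` B \<inter> space M"
      by (auto simp: B'_def space_PiM)
    have "prob ((\<lambda>\<omega>. (?H \<omega>, ?K \<omega>)) -` (S' \<times> B') \<inter> space M) =
        prob (?H -` S' \<inter> space M) * prob (?K -` B' \<inter> space M)"
      by (rule indep_varD[OF I S'(1) B'])
    moreover have "(\<lambda>\<omega>. (?H \<omega>, ?K \<omega>)) -` (S' \<times> B') \<inter> space M = (\<lambda>\<omega>. (\<omega>, ?Y \<omega>)) -` (S \<times> B) \<inter> space M"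
      using KB S' by blast
    ultimately have "prob ((\<lambda>\<omega>. (\<omega>, ?Y \<omega>)) -` (S \<times> B) \<inter> space M) = prob S * prob (?Y -` B \<inter> space M)"
      using KB S' by simp
    moreover have "(\<lambda>\<omega>. \<omega>) -` S \<inter> space M = S" using S' by auto
    ultimately show "emeasure (distr M (hist X A) (\<lambda>\<omega>. \<omega>)) S * emeasure (distr M borel ?Y) B =
        emeasure (distr M (hist X A \<Otimes>\<^sub>M borel) (\<lambda>\<omega>. (\<omega>, ?Y \<omega>))) (S \<times> B)"
      using S id pair by (simp add: emeasure_distr emeasure_eq_measure ennreal_mult[symmetric])
  qed (intro D1.sigma_finite_measure_axioms D2.sigma_finite_measure_axioms)+
  then show ?thesis using id by (simp add: indep_of_def)
qed

end

text \<open>\<open>G s\<close> is what is known just before \<open>Y s\<close> is drawn, so weights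
  \<open>z s\<close> measurable for \<open>G s\<close> are predictable. The two instances are the
  centred information entries in \<open>AE_psi_average\<close> and the noise in
  \<open>AE_noise_sum\<close>.\<close>

locale innovations = prob_space +
  fixes G :: "nat \<Rightarrow> 'a measure" and Y :: "nat \<Rightarrow> 'a \<Rightarrow> real" and v :: real
  assumes indep: "\<And>s. indep_of (G s) (Y s)"
    and space_G: "\<And>s. space (G s) = space M"
    and G_mono: "\<And>s. sets (G s) \<subseteq> sets (G (Suc s))"
    and Y_adapted: "\<And>s. Y s \<in> borel_measurable (G (Suc s))"
    and Y_centred: "\<And>s. integrable M (Y s)" "\<And>s. expectation (Y s) = 0"
    and Y_variance: "\<And>s. integrable M (\<lambda>\<omega>. (Y s \<omega>)\<^sup>2)" "\<And>s. expectation (\<lambda>\<omega>. (Y s \<omega>)\<^sup>2) \<le> v"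
begin

lemma measurable_G_mono:
  assumes f: "f \<in> borel_measurable (G s)" and "s \<le> t"
  shows "f \<in> borel_measurable (G t)"
  using assms(2)
proof (induction rule: dec_induct)
  case (step n)
  then show ?case using G_mono[of n] space_G by (auto simp: measurable_def)
qed (rule f)

lemma measurable_G_M: "f \<in> borel_measurable (G s) \<Longrightarrow> f \<in> borel_measurable M"
proof -
  assume f: "f \<in> borel_measurable (G s)"
  have "(\<lambda>\<omega>. \<omega>) \<in> measurable M (G s)" using indep by (auto simp: indep_of_def)
  from measurable_compose[OF this f] show ?thesis by simp
qed

text \<open>The logarithm of the supermartingale, which is \<open>exp (supermart z c t)\<close>
  itself; the subtracted squares are the compensator given by \<open>nn_integral_exp_clip_le\<close>
  with \<open>c * z s\<close> frozen.\<close>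

definition supermart :: "(nat \<Rightarrow> 'a \<Rightarrow> real) \<Rightarrow> real \<Rightarrow> nat \<Rightarrow> 'a \<Rightarrow> real" where
  "supermart z c t \<omega> = (\<Sum>s<t. clip (c * (z s \<omega> * Y s \<omega>)) - 2 * v * (c * z s \<omega>)\<^sup>2)"

lemma supermart_measurable:
  assumes z: "\<And>s. z s \<in> borel_measurable (G s)"
  shows "supermart z c t \<in> borel_measurable (G t)"
  unfolding supermart_def
proof (intro borel_measurable_sum)
  fix s assume "s \<in> {..<t}"
  then have "z s \<in> borel_measurable (G t)" "Y s \<in> borel_measurable (G t)"
    using measurable_G_mono[OF z[of s], of t] measurable_G_mono[OF Y_adapted[of s], of t] by auto
  then show "(\<lambda>\<omega>. clip (c * (z s \<omega> * Y s \<omega>)) - 2 * v * (c * z s \<omega>)\<^sup>2) \<in> borel_measurable (G t)"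
    by measurable
qed

text \<open>With the past frozen, the newest exponential factor has mean at most
  \<open>exp (2 * v * (c * z t)\<^sup>2)\<close>, and the compensator cancels exactly this.\<close>

lemma nn_integral_exp_supermart_le_1:
  assumes z: "\<And>s. z s \<in> borel_measurable (G s)"
  shows "(\<integral>\<^sup>+\<omega>. ennreal (exp (supermart z c t \<omega>)) \<partial>M) \<le> 1"
proof (induction t)
  case 0
  then show ?case by (simp add: supermart_def emeasure_space_1)
next
  case (Suc t)
  have zm[measurable]: "z t \<in> borel_measurable (G t)" by (rule z)
  have Em[measurable]: "supermart z c t \<in> borel_measurable (G t)" by (rule supermart_measurable[OF z])
  define f where "f = (\<lambda>(\<omega>, y). ennreal (exp (supermart z c t \<omega> - 2 * v * (c * z t \<omega>)\<^sup>2)) *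
      ennreal (exp (clip ((c * z t \<omega>) * y))))"
  have f: "f \<in> borel_measurable (G t \<Otimes>\<^sub>M borel)" unfolding f_def by measurable
  have "(\<integral>\<^sup>+\<omega>. ennreal (exp (supermart z c (Suc t) \<omega>)) \<partial>M) = (\<integral>\<^sup>+\<omega>. f (\<omega>, Y t \<omega>) \<partial>M)"
    by (intro nn_integral_cong)
      (simp add: f_def supermart_def ennreal_mult[symmetric] exp_add[symmetric] mult.assoc algebra_simps)
  also have "\<dots> = (\<integral>\<^sup>+\<omega>. (\<integral>\<^sup>+\<omega>'. f (\<omega>, Y t \<omega>') \<partial>M) \<partial>M)"
    by (rule nn_integral_indep_pair[OF indep f])
  also have "\<dots> \<le> (\<integral>\<^sup>+\<omega>. ennreal (exp (supermart z c t \<omega>)) \<partial>M)"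
  proof (rule nn_integral_mono)
    fix \<omega>
    have Ym: "Y t \<in> borel_measurable M" using Y_centred(1) by auto
    have "(\<integral>\<^sup>+\<omega>'. f (\<omega>, Y t \<omega>') \<partial>M) =
        ennreal (exp (supermart z c t \<omega> - 2 * v * (c * z t \<omega>)\<^sup>2)) *
        (\<integral>\<^sup>+\<omega>'. ennreal (exp (clip ((c * z t \<omega>) * Y t \<omega>'))) \<partial>M)"
      unfolding f_def using Ym by (simp add: nn_integral_cmult)
    also have "\<dots> \<le> ennreal (exp (supermart z c t \<omega> - 2 * v * (c * z t \<omega>)\<^sup>2)) *
        ennreal (exp (2 * v * (c * z t \<omega>)\<^sup>2))"
      by (intro mult_left_mono nn_integral_exp_clip_le Y_centred Y_variance) auto
    also have "\<dots> = ennreal (exp (supermart z c t \<omega>))"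
      by (simp add: ennreal_mult[symmetric] exp_add[symmetric])
    finally show "(\<integral>\<^sup>+\<omega>'. f (\<omega>, Y t \<omega>') \<partial>M) \<le> ennreal (exp (supermart z c t \<omega>))" .
  qed
  also note Suc.IH
  finally show ?case .
qed

text \<open>Each \<open>t\<close> has its own supermartingale, with parameter \<open>c t\<close>,
  evaluated at time \<open>t\<close> only; hence \<open>c\<close> may vary with \<open>t\<close>
  freely. Markov's inequality at level \<open>2 * ln t\<close> leaves a probability of at most
  \<open>1 / t\<^sup>2\<close>, which is summable.\<close>

lemma AE_clipped_sum_le:
  assumes z: "\<And>s. z s \<in> borel_measurable (G s)"
  shows "AE \<omega> in M. eventually (\<lambda>t. (\<Sum>s<t. clip (c t * (z s \<omega> * Y s \<omega>))) \<le>
     2 * v * (c t)\<^sup>2 * (\<Sum>s<t. (z s \<omega>)\<^sup>2) + 2 * ln (real t)) sequentially"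
proof -
  define A where "A t = {\<omega> \<in> space M. supermart z (c t) t \<omega> > 2 * ln (real t)}" for t
  have Em[measurable]: "supermart z a t \<in> borel_measurable M" for a t
    using supermart_measurable[OF z] measurable_G_M by blast
  have A[measurable]: "A t \<in> sets M" for t unfolding A_def by measurable
  have bound: "measure M (A t) \<le> 1 / (real t)\<^sup>2" if t: "t \<ge> 1" for t
  proof -
    have pw: "ennreal ((real t)\<^sup>2) * indicator (A t) \<omega> \<le> ennreal (exp (supermart z (c t) t \<omega>))" for \<omega>
    proof (cases "\<omega> \<in> A t")
      case True
      have "(real t)\<^sup>2 = exp (2 * ln (real t))"
        using t by (simp add: exp_double)
      also have "\<dots> \<le> exp (supermart z (c t) t \<omega>)" using True by (simp add: A_def)
      finally show ?thesis using True by (simp add: ennreal_leI)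
    qed simp
    have "ennreal ((real t)\<^sup>2) * emeasure M (A t) = (\<integral>\<^sup>+\<omega>. ennreal ((real t)\<^sup>2) * indicator (A t) \<omega> \<partial>M)"
      by (simp add: nn_integral_cmult_indicator)
    also have "\<dots> \<le> (\<integral>\<^sup>+\<omega>. ennreal (exp (supermart z (c t) t \<omega>)) \<partial>M)"
      by (intro nn_integral_mono pw)
    also have "\<dots> \<le> 1" by (rule nn_integral_exp_supermart_le_1[OF z])
    finally have "ennreal ((real t)\<^sup>2 * measure M (A t)) \<le> ennreal 1"
      by (simp add: ennreal_mult emeasure_eq_measure)
    then have "(real t)\<^sup>2 * measure M (A t) \<le> 1" by (subst (asm) ennreal_le_iff) auto
    then show ?thesis using t by (simp add: field_simps)
  qed
  have "summable (\<lambda>t. measure M (A t))"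
  proof (rule summable_comparison_test'[where N = 1])
    show "summable (\<lambda>t. 1 / (real t)\<^sup>2)"
      using inverse_power_summable[of 2, where 'a = real] by (simp add: divide_inverse)
  qed (use bound in auto)
  then have "AE \<omega> in M. eventually (\<lambda>t. \<omega> \<in> space M - A t) sequentially"
    by (intro borel_cantelli_AE1) (auto simp: emeasure_eq_measure)
  then show ?thesis
  proof (rule AE_mp, intro AE_I2 impI)
    fix \<omega> assume "\<omega> \<in> space M" and ev: "eventually (\<lambda>t. \<omega> \<in> space M - A t) sequentially"
    show "eventually (\<lambda>t. (\<Sum>s<t. clip (c t * (z s \<omega> * Y s \<omega>))) \<le>
       2 * v * (c t)\<^sup>2 * (\<Sum>s<t. (z s \<omega>)\<^sup>2) + 2 * ln (real t)) sequentially"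
      using ev
    proof (rule eventually_mono)
      fix t assume "\<omega> \<in> space M - A t"
      then have "supermart z (c t) t \<omega> \<le> 2 * ln (real t)" by (auto simp: A_def)
      then show "(\<Sum>s<t. clip (c t * (z s \<omega> * Y s \<omega>))) \<le>
          2 * v * (c t)\<^sup>2 * (\<Sum>s<t. (z s \<omega>)\<^sup>2) + 2 * ln (real t)"
        by (simp add: supermart_def sum_subtractf sum_distrib_left power_mult_distrib mult.assoc)
    qed
  qed
qed

lemma AE_clipped_sum_abs_le:
  assumes z: "\<And>s. z s \<in> borel_measurable (G s)"
  shows "AE \<omega> in M. eventually (\<lambda>t. \<bar>\<Sum>s<t. clip (c t * (z s \<omega> * Y s \<omega>))\<bar> \<le>
     2 * v * (c t)\<^sup>2 * (\<Sum>s<t. (z s \<omega>)\<^sup>2) + 2 * ln (real t)) sequentially"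
  using AE_clipped_sum_le[OF z, of c] AE_clipped_sum_le[OF z, of "\<lambda>t. - c t"]
proof eventually_elim
  case (elim \<omega>)
  have neg: "clip (- x) = - clip x" for x by (simp add: clip_def)
  from elim show ?case
    by eventually_elim (simp add: neg sum_negf abs_le_iff)
qed

end

section \<open>The algorithm along a fixed sample path\<close>

locale raid = agent d lo hi m Mx \<theta>s
  for d :: nat and lo hi m Mx :: real and \<theta>s :: "real vec" +
  fixes \<Sigma>0 :: "real mat" and \<theta>0 :: "real vec" and xdes \<gamma> :: real
  assumes xdes_interior: "lo < xdes" "xdes < hi"
    and Sigma0: "pos_def d \<Sigma>0" and theta0: "\<theta>0 \<in> carrier_vec d"
    and gamma: "2/3 \<le> \<gamma>" "\<gamma> < 1"
begin

abbreviation state where "state w e t \<equiv> raid_state d lo hi \<theta>s \<Sigma>0 \<theta>0 xdes \<gamma> w e t"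

definition interior_ind :: "real \<Rightarrow> real" where
  "interior_ind p = (if lo < br p \<and> br p < hi then 1 else 0)"

definition feature :: "real \<Rightarrow> real vec" where "feature p = dPhi d (br p)"

text \<open>The inverse of \<open>\<Sigma>\<close>; it depends on the probing draws only, not on the noise.\<close>
fun info :: "(nat \<Rightarrow> real) \<Rightarrow> nat \<Rightarrow> real mat" where
  "info w 0 = mat_inv \<Sigma>0"
| "info w (Suc t) = (if explore \<gamma> (Suc t) (mat_inv (info w t))
     then info w t + interior_ind (w (Suc t)) \<cdot>\<^sub>m outer (feature (w (Suc t))) else info w t)"

text \<open>Time is shifted by one: index \<open>t\<close> of \<open>explores\<close> and \<open>eps\<close> describes the decision taken at
  time \<open>Suc t\<close>, based on the state after time \<open>t\<close>.\<close>
definition explores :: "(nat \<Rightarrow> real) \<Rightarrow> nat \<Rightarrow> bool" where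
  "explores w t \<longleftrightarrow> explore \<gamma> (Suc t) (mat_inv (info w t))"

definition eps :: "(nat \<Rightarrow> real) \<Rightarrow> nat \<Rightarrow> real" where
  "eps w t = (if explores w t then 1 else 0)"

definition num :: "(nat \<Rightarrow> real) \<Rightarrow> nat \<Rightarrow> real" where
  "num w t = (\<Sum>s<t. eps w s)"

lemma feature_carrier [simp]: "feature p \<in> carrier_vec d"
  by (simp add: feature_def)

lemma dim_feature [simp]: "dim_vec (feature p) = d"
  by (rule carrier_vecD[OF feature_carrier])

lemma interior_ind_range: "0 \<le> interior_ind p" "interior_ind p \<le> 1" "(interior_ind p)\<^sup>2 = interior_ind p"
  by (auto simp: interior_ind_def)

lemma eps_range: "0 \<le> eps w t" "eps w t \<le> 1" "(eps w t)\<^sup>2 = eps w t"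
  by (auto simp: eps_def)

lemma num_mono: "s \<le> t \<Longrightarrow> num w s \<le> num w t"
  unfolding num_def by (intro sum_mono2) (auto simp: eps_range)

lemma num_nonneg: "0 \<le> num w t"
  unfolding num_def by (intro sum_nonneg) (simp add: eps_range)

lemma d_pos: "0 < d"
proof (rule ccontr)
  assume "\<not> 0 < d"
  then have "\<theta>s \<bullet> d2Phi d lo = 0" by (simp add: scalar_prod_def d2Phi_def)
  moreover have "m \<le> \<theta>s \<bullet> d2Phi d lo" using theta_in lo_less_hi by (auto simp: Theta_def)
  ultimately show False using m_pos by simp
qed

lemma pos_def_info: "pos_def d (info w t)"
  by (induction t) (auto simp: pos_def_mat_inv[OF Sigma0] pos_def_add_outer interior_ind_range)

lemma info_carrier [simp]: "info w t \<in> carrier_mat d d"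
  using pos_def_info by (simp add: pos_def_def)

lemma dim_info [simp]: "dim_row (info w t) = d" "dim_col (info w t) = d"
  using carrier_matD[OF info_carrier[of w t]] .

lemma state_Sigma: "fst (state w e t) = mat_inv (info w t)"
proof (induction t)
  case 0
  then show ?case by (simp add: pos_def_inverse(4)[OF Sigma0])
next
  case (Suc t)
  then show ?case
    using pos_def_inverse(4)[OF pos_def_info[of w t]]
    by (cases "state w e t") (simp add: Let_def price_def interior_ind_def feature_def)
qed

lemma info_entry:
  assumes "j < d" "k < d"
  shows "info w t $$ (j,k) = mat_inv \<Sigma>0 $$ (j,k) +
    (\<Sum>s<t. eps w s * (interior_ind (w (Suc s)) * feature (w (Suc s)) $ j * feature (w (Suc s)) $ k))"
proof (induction t)
  case (Suc t)
  then show ?case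
    using assms by (simp add: eps_def explores_def outer_def)
qed simp

lemma state_theta_carrier: "snd (state w e t) \<in> carrier_vec d"
proof (induction t)
  case (Suc t)
  have "fst (state w e t) \<in> carrier_mat d d"
    using pos_def_inverse(1)[OF pos_def_info] by (simp add: state_Sigma)
  moreover have "mat_inv (info w t + interior_ind (w (Suc t)) \<cdot>\<^sub>m outer (feature (w (Suc t)))) \<in> carrier_mat d d"
    by (intro pos_def_inverse(1) pos_def_add_outer pos_def_info feature_carrier interior_ind_range)
  moreover have "mat_inv (fst (state w e t)) = info w t"
    using pos_def_inverse(4)[OF pos_def_info[of w t]] by (simp add: state_Sigma)
  ultimately show ?case
    using Suc by (cases "state w e t") (auto simp: Let_def price_def interior_ind_def feature_def)
qed (simp add: theta0)

text \<open>Substituting the signal cancels the true parameter: the residual is the feature applied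
  to the current error, plus noise.\<close>

lemma state_theta_explore:
  assumes "explores w t"
  shows "snd (state w e (Suc t)) = snd (state w e t) -
    (interior_ind (w (Suc t)) * (feature (w (Suc t)) \<bullet> (snd (state w e t) - \<theta>s) + e (Suc t))) \<cdot>\<^sub>v
      (mat_inv (info w (Suc t)) *\<^sub>v feature (w (Suc t)))"
proof -
  have "mat_inv (fst (state w e t)) = info w t"
    using pos_def_inverse(4)[OF pos_def_info[of w t]] by (simp add: state_Sigma)
  moreover have "explore \<gamma> (Suc t) (fst (state w e t))"
    using assms by (simp add: explores_def state_Sigma)
  moreover have "feature p \<bullet> (snd (state w e t) - \<theta>s) + e (Suc t) =
      e (Suc t) - \<theta>s \<bullet> feature p + feature p \<bullet> snd (state w e t)" for p
    using state_theta_carrier[of w e t] theta_carrier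
    by (simp add: scalar_prod_minus_distrib[of _ d] comm_scalar_prod[of \<theta>s d])
  ultimately show ?thesis using assms
    by (cases "state w e t") (simp add: Let_def price_def interior_ind_def feature_def explores_def,
        simp add: algebra_simps)
qed

lemma state_theta_exploit:
  assumes "\<not> explores w t" shows "state w e (Suc t) = state w e t"
  using assms state_Sigma[of w e t]
  by (cases "state w e t") (auto simp: Let_def price_def explores_def)

definition err :: "(nat \<Rightarrow> real) \<Rightarrow> (nat \<Rightarrow> real) \<Rightarrow> nat \<Rightarrow> real vec" where
  "err w e t = snd (state w e t) - \<theta>s"

lemma err_carrier [simp]: "err w e t \<in> carrier_vec d"
  using state_theta_carrier theta_carrier by (simp add: err_def)

text \<open>Multiplying the update by the new information matrix removes its inverse, and the
  rank-one growth of that matrix contributes \<open>\<delta> * (\<xi> \<bullet> err)\<close> along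
  \<open>\<xi>\<close>, which the correction term cancels. Only the noise survives, so the recursion
  becomes a plain sum.\<close>

lemma noise_recursion:
  assumes "j < d"
  shows "(info w t *\<^sub>v err w e t) $ j = (mat_inv \<Sigma>0 *\<^sub>v (\<theta>0 - \<theta>s)) $ j -
    (\<Sum>s<t. eps w s * (interior_ind (w (Suc s)) * feature (w (Suc s)) $ j) * e (Suc s))"
proof (induction t)
  case 0
  then show ?case by (simp add: err_def)
next
  case (Suc t)
  show ?case
  proof (cases "explores w t")
    case False
    then show ?thesis using Suc state_theta_exploit[OF False, of e]
      by (simp add: eps_def err_def explores_def)
  next
    case True
    define \<xi> \<delta> P P' where "\<xi> = feature (w (Suc t))" and "\<delta> = interior_ind (w (Suc t))"
      and "P = info w t" and "P' = info w (Suc t)"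
    have c[simp]: "\<xi> \<in> carrier_vec d" "P \<in> carrier_mat d d" "P' \<in> carrier_mat d d"
      by (auto simp: \<xi>_def P_def P'_def simp del: info.simps)
    have P': "P' = P + \<delta> \<cdot>\<^sub>m outer \<xi>"
      using True by (simp add: P'_def P_def \<delta>_def \<xi>_def explores_def)
    note I = pos_def_inverse[OF pos_def_info[of w "Suc t"], folded P'_def]
    define a where "a = \<delta> * (\<xi> \<bullet> err w e t + e (Suc t))"
    have "err w e (Suc t) = err w e t - a \<cdot>\<^sub>v (mat_inv P' *\<^sub>v \<xi>)"
      unfolding err_def state_theta_explore[OF True] P'_def[symmetric] \<xi>_def[symmetric] \<delta>_def[symmetric] a_def
      using state_theta_carrier[of w e t] theta_carrier I(1)
      by (intro eq_vecI) (auto simp: err_def)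
    moreover have "P' *\<^sub>v (err w e t - a \<cdot>\<^sub>v (mat_inv P' *\<^sub>v \<xi>)) = P' *\<^sub>v err w e t - a \<cdot>\<^sub>v \<xi>"
    proof -
      have "P' *\<^sub>v (mat_inv P' *\<^sub>v \<xi>) = \<xi>"
        using assoc_mult_mat_vec[OF c(3) I(1) c(1)] I(2) by simp
      then show ?thesis
        using I(1) by (simp add: mult_minus_distrib_mat_vec[of _ d d] mult_mat_vec[of _ d d])
    qed
    moreover have "P' *\<^sub>v err w e t = P *\<^sub>v err w e t + (\<delta> * (\<xi> \<bullet> err w e t)) \<cdot>\<^sub>v \<xi>"
      unfolding P' by (simp add: add_mult_distrib_mat_vec[of _ d d]
          smult_mat_mult_vec[OF outer_carrier[OF c(1)]] outer_mult_vec[of _ d] smult_smult_assoc)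
    ultimately have "(P' *\<^sub>v err w e (Suc t)) $ j = (P *\<^sub>v err w e t) $ j - \<delta> * \<xi> $ j * e (Suc t)"
      using assms carrier_vecD[OF c(1)] carrier_matD[OF c(2)]
      by (simp add: a_def algebra_simps del: c)
    then show ?thesis using Suc.IH True
      by (simp add: P_def P'_def \<delta>_def \<xi>_def eps_def del: info.simps)
  qed
qed

section \<open>The schedule against the number of explorations\<close>

lemma A_sched_mono: "s \<le> t \<Longrightarrow> A_sched \<gamma> s \<le> A_sched \<gamma> t"
proof -
  assume "s \<le> t"
  then show ?thesis using gamma
    by (auto simp: A_sched_def intro!: mult_mono powr_mono2)
qed

lemma A_sched_nonneg: "0 \<le> A_sched \<gamma> t"
  using A_sched_mono[of 0 t] by (simp add: A_sched_def)

text \<open>Because \<gamma> < 1, the increments of the schedule tend to 0. A bounded increment is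
  what one exploration per step can keep up with; \<open>B \<ge> 1\<close> yields
  \<open>num \<le> B * num\<close> at exploitation steps.\<close>

lemma A_sched_increment_bounded: "\<exists>B\<ge>1. \<forall>t. A_sched \<gamma> (Suc t) \<le> A_sched \<gamma> t + B"
proof -
  have "(\<lambda>t::nat. (real t + 1) powr \<gamma> * ln (real t + 1) - real t powr \<gamma> * ln (real t)) \<longlonglongrightarrow> 0"
    using gamma by real_asymp
  then have "Bseq (\<lambda>t::nat. (real t + 1) powr \<gamma> * ln (real t + 1) - real t powr \<gamma> * ln (real t))"
    by (intro convergent_imp_Bseq convergentI)
  then obtain K where K: "\<And>t. \<bar>(real t + 1) powr \<gamma> * ln (real t + 1) - real t powr \<gamma> * ln (real t)\<bar> \<le> K"
    unfolding Bseq_def by auto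
  have "A_sched \<gamma> (Suc t) \<le> A_sched \<gamma> t + max 1 K" for t
    using K[of t] by (auto simp: A_sched_def add.commute)
  then show ?thesis by (intro exI[of _ "max 1 K"]) auto
qed

text \<open>The first entry of every feature is \<open>1\<close>, so the \<open>(0,0)\<close> entry of the information matrix
  grows by at most one per exploration and bounds the trace of its inverse from below.\<close>
lemma A_sched_le_num: "\<exists>B\<ge>1. \<exists>C. \<forall>w t. A_sched \<gamma> t \<le> C + B * num w t"
proof -
  obtain B where B: "B \<ge> 1" "\<And>t. A_sched \<gamma> (Suc t) \<le> A_sched \<gamma> t + B"
    using A_sched_increment_bounded by auto
  define p where "p = mat_inv \<Sigma>0 $$ (0,0)"
  have entry: "info w t $$ (0,0) \<le> p + num w t" for w t
  proof -
    have "feature q $ 0 = 1" for q using d_pos by (simp add: feature_def dPhi_def)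
    then have "info w t $$ (0,0) = p + (\<Sum>s<t. eps w s * interior_ind (w (Suc s)))"
      using info_entry[of 0 0 w t] d_pos by (simp add: p_def)
    also have "\<dots> \<le> p + num w t" unfolding num_def
      using eps_range interior_ind_range by (intro add_left_mono sum_mono) (simp add: mult_left_le)
    finally show ?thesis .
  qed
  have quad: "unit_vec d 0 \<bullet> (info w t *\<^sub>v unit_vec d 0) = info w t $$ (0,0)" for w t
    using d_pos by (intro quad_unit_vec) simp_all
  have pos: "info w t $$ (0,0) > 0" for w t
  proof -
    have "unit_vec d 0 \<noteq> (0\<^sub>v d :: real vec)" using d_pos by simp
    then have "unit_vec d 0 \<bullet> (info w t *\<^sub>v unit_vec d 0) > 0"
      using pos_def_info[of w t] by (simp add: pos_def_def)
    then show ?thesis by (simp add: quad)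
  qed
  have "p > 0" using pos[of _ 0] by (simp add: p_def)
  have exploit: "A_sched \<gamma> t \<le> p + num w t" if "\<not> explores w t" for w t
  proof -
    have A: "A_sched \<gamma> t > 0" "mat_trace (mat_inv (info w t)) \<le> 1 / A_sched \<gamma> t"
      using that by (auto simp: explores_def explore_def)
    have "1 \<le> mat_trace (mat_inv (info w t)) * info w t $$ (0,0)"
      using sq_norm_le_trace_inverse[OF pos_def_info[of w t], of "unit_vec d 0"] d_pos
      by (simp add: quad)
    also have "\<dots> \<le> 1 / A_sched \<gamma> t * info w t $$ (0,0)"
      using A(2) pos[of w t] by (intro mult_right_mono) auto
    finally have "A_sched \<gamma> t \<le> info w t $$ (0,0)" using A(1) by (simp add: field_simps)
    then show ?thesis using entry[of w t] by simp
  qed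
  \<comment> \<open>The offset leaves room for one step of growth: at an exploitation decision the
    schedule is at most \<open>p + num\<close>, and it then rises by at most
    \<open>B\<close>.\<close>
  have "A_sched \<gamma> t \<le> (p + B) + B * num w t" for w t
  proof (induction t)
    case 0
    then show ?case using \<open>p > 0\<close> B by (simp add: A_sched_def num_def)
  next
    case (Suc t)
    show ?case
    proof (cases "explores w t")
      case True
      then have "num w (Suc t) = num w t + 1" by (simp add: num_def eps_def)
      then show ?thesis using Suc B(2)[of t] by (simp add: algebra_simps)
    next
      case False
      then have "num w (Suc t) = num w t" by (simp add: num_def eps_def)
      moreover have "num w t \<le> B * num w t" using B(1) num_nonneg[of w t] by (simp add: mult_le_cancel_right1)
      ultimately show ?thesis using exploit[OF False] B(2)[of t] by simp
    qed
  qed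
  then show ?thesis using B(1) by blast
qed

end

text \<open>Compares \<open>s powr (-1/2)\<close> with the telescoping increments of
  \<open>2 * sqrt s\<close>. These dominate \<open>1 / sqrt (s + 1)\<close>; the second telescoping
  difference \<open>2 / sqrt s - 2 / sqrt (s + 1)\<close> covers the shift of index.\<close>

lemma sum_le_sqrt_of_eventually:
  fixes f :: "nat \<Rightarrow> real"
  assumes "eventually (\<lambda>s. f s \<le> K * real s powr (-1/2)) sequentially" "K \<ge> 0"
  shows "\<exists>C. \<forall>t. (\<Sum>s<t. f s) \<le> C + 2 * K * sqrt (real t)"
proof -
  obtain T where T: "T \<ge> 1" "\<And>s. s \<ge> T \<Longrightarrow> f s \<le> K * real s powr (-1/2)"
    using assms(1) unfolding eventually_sequentially by (metis le_trans nat_le_linear)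
  define C where "C = (\<Sum>s<T. \<bar>f s\<bar>) + 2 * K"
  have step: "real s powr (-1/2) \<le> 2 * sqrt (real (Suc s)) - 2 * sqrt (real s) + (2 / sqrt (real s) - 2 / sqrt (real (Suc s)))"
    if "s \<ge> 1" for s :: nat
  proof -
    define a b where "a = sqrt (real s)" and "b = sqrt (real (Suc s))"
    have ab: "a \<ge> 1" "a \<le> b" using that by (auto simp: a_def b_def)
    have "b\<^sup>2 - a\<^sup>2 = 1" by (simp add: a_def b_def)
    then have e: "(b - a) * (b + a) = 1" by (simp add: algebra_simps power2_eq_square)
    have "1 / b \<le> 2 * b - 2 * a"
    proof -
      have "(b - a) * (2 * b) \<ge> (b - a) * (b + a)" using ab by (intro mult_left_mono) auto
      then show ?thesis using e ab by (simp add: field_simps)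
    qed
    moreover have "1 / b \<le> 1 / a" using ab by (intro divide_left_mono) auto
    ultimately have "1 / a \<le> 2 * b - 2 * a + (2 / a - 2 / b)" by (simp add: field_simps)
    moreover have "real s powr (-1/2) = 1 / a" using that
      by (simp add: a_def powr_minus_divide powr_half_sqrt)
    ultimately show ?thesis by (simp add: a_def b_def)
  qed
  \<comment> \<open>The subtracted term carries the telescoped correction through the induction. It
    is at most \<open>2 * K\<close>, which is why \<open>C\<close> contains that summand;
    \<open>max 1 t\<close> gives it the right value at \<open>t = 0\<close>.\<close>
  have main: "(\<Sum>s<t. f s) \<le> C - 2 * K * (1 / sqrt (real (max 1 t))) + 2 * K * sqrt (real t)" for t
  proof (induction t)
    case 0
    have "(\<Sum>s<T. \<bar>f s\<bar>) \<ge> 0" by (intro sum_nonneg) auto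
    then show ?case by (simp add: C_def)
  next
    case (Suc t)
    show ?case
    proof (cases "t \<ge> T")
      case True
      then have "f t \<le> K * (2 * sqrt (real (Suc t)) - 2 * sqrt (real t) + (2 / sqrt (real t) - 2 / sqrt (real (Suc t))))"
        using T step[of t] assms(2) order_trans mult_left_mono by (meson le_trans)
      then show ?thesis using Suc True T(1) by (simp add: algebra_simps max_def)
    next
      case False
      have "(\<Sum>s<Suc t. f s) \<le> (\<Sum>s<Suc t. \<bar>f s\<bar>)" by (intro sum_mono) auto
      also have "\<dots> \<le> (\<Sum>s<T. \<bar>f s\<bar>)" using False by (intro sum_mono2) auto
      also have "\<dots> \<le> C - 2 * K * (1 / sqrt (real (max 1 (Suc t)))) + 2 * K * sqrt (real (Suc t))"
      proof -
        have "1 / sqrt (real (max 1 (Suc t))) \<le> 1" by simp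
        then have "2 * K * (1 / sqrt (real (max 1 (Suc t)))) \<le> 2 * K"
          using assms(2) by (intro mult_left_le) auto
        moreover have "2 * K * sqrt (real (Suc t)) \<ge> 0" using assms(2) by simp
        ultimately show ?thesis by (simp add: C_def)
      qed
      finally show ?thesis .
    qed
  qed
  have "(\<Sum>s<t. f s) \<le> C + 2 * K * sqrt (real t)" for t
  proof -
    have "2 * K * (1 / sqrt (real (max 1 t))) \<ge> 0" using assms(2) by simp
    with main[of t] show ?thesis by linarith
  qed
  then show ?thesis by blast
qed

section \<open>Exploration count, estimation error and regret on an excited sample path\<close>

context raid
begin

text \<open>Persistent excitation, measured against the number of explorations instead of time.
  Uniformity in \<open>v\<close> makes it a bound on the least eigenvalue of the information
  matrix.\<close>

definition excited :: "(nat \<Rightarrow> real) \<Rightarrow> bool" where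
  "excited w \<longleftrightarrow> (\<exists>c>0. eventually (\<lambda>t. \<forall>v\<in>carrier_vec d.
     c * num w t * (v \<bullet> v) \<le> v \<bullet> (info w t *\<^sub>v v)) sequentially)"

lemma num_lower: "\<exists>c>0. eventually (\<lambda>t. c * (real t powr \<gamma> * ln (real t)) \<le> num w t) sequentially"
proof -
  obtain B C where B: "B \<ge> 1" and A: "\<And>t. A_sched \<gamma> t \<le> C + B * num w t"
    using A_sched_le_num by blast
  have "eventually (\<lambda>t::nat. 2 * C \<le> real t powr \<gamma> * ln (real t)) sequentially"
    using gamma by real_asymp
  \<comment> \<open>Once the schedule exceeds \<open>2 * C\<close>, half of it absorbs
    \<open>C\<close>; hence the factor 2.\<close>
  then have "eventually (\<lambda>t. 1 / (2 * B) * (real t powr \<gamma> * ln (real t)) \<le> num w t) sequentially"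
    using eventually_gt_at_top[of 0]
  proof eventually_elim
    case (elim t)
    have "real t powr \<gamma> * ln (real t) \<le> C + B * num w t"
      using A[of t] elim by (simp add: A_sched_def)
    then show ?case using elim B by (simp add: field_simps)
  qed
  then show ?thesis using B by (intro exI[of _ "1 / (2 * B)"]) auto
qed

text \<open>A late exploration means \<open>1 / A < tr \<Sigma> \<le> d / (c * N)\<close>, so
  \<open>N \<le> D * A\<close> just before it and \<open>N\<close> overshoots by at most one.
  Exploitation leaves \<open>N\<close> fixed while the schedule does not decrease.\<close>

lemma num_upper:
  assumes "excited w"
  shows "\<exists>C>0. eventually (\<lambda>t. num w t \<le> C * (real t powr \<gamma> * ln (real t))) sequentially"
proof -
  obtain c where c: "c > 0" "eventually (\<lambda>t. \<forall>v\<in>carrier_vec d. c * num w t * (v \<bullet> v) \<le> v \<bullet> (info w t *\<^sub>v v)) sequentially"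
    using assms by (auto simp: excited_def)
  obtain c' where c': "c' > 0" "eventually (\<lambda>t. c' * (real t powr \<gamma> * ln (real t)) \<le> num w t) sequentially"
    using num_lower by blast
  have "eventually (\<lambda>t. (\<forall>v\<in>carrier_vec d. c * num w t * (v \<bullet> v) \<le> v \<bullet> (info w t *\<^sub>v v)) \<and> num w t > 0 \<and> t \<ge> 2) sequentially"
    using c(2) c'(2) eventually_ge_at_top[of 2]
  proof eventually_elim
    case (elim t)
    have "0 < c' * (real t powr \<gamma> * ln (real t))" using c'(1) elim(3) by simp
    then show ?case using elim by auto
  qed
  then obtain T where T: "\<And>t v. t \<ge> T \<Longrightarrow> v \<in> carrier_vec d \<Longrightarrow> c * num w t * (v \<bullet> v) \<le> v \<bullet> (info w t *\<^sub>v v)"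
     "\<And>t. t \<ge> T \<Longrightarrow> num w t > 0" "\<And>t. t \<ge> T \<Longrightarrow> t \<ge> 2"
    unfolding eventually_sequentially by blast
  define D where "D = real d / c"
  have D: "D > 0" using c(1) d_pos by (simp add: D_def)
  have explore: "num w t \<le> D * A_sched \<gamma> t" if t: "t \<ge> T" and ex: "explores w t" for t
  proof -
    have Apos: "A_sched \<gamma> t > 0" using T(3)[OF t] by (simp add: A_sched_def)
    then have "1 / A_sched \<gamma> t < mat_trace (mat_inv (info w t))"
      using ex by (simp add: explores_def explore_def)
    also have "\<dots> \<le> real d / (c * num w t)"
      using T(1,2)[OF t] c(1) by (intro trace_inverse_le[OF pos_def_info]) auto
    finally show ?thesis using Apos T(2)[OF t] c(1) by (simp add: D_def field_simps)
  qed
  have "num w t \<le> num w T + 1 + D * A_sched \<gamma> t" if "t \<ge> T" for t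
    using that
  proof (induction rule: dec_induct)
    case base
    then show ?case using D A_sched_nonneg by simp
  next
    case (step t)
    have mono: "D * A_sched \<gamma> t \<le> D * A_sched \<gamma> (Suc t)"
      using D A_sched_mono[of t "Suc t"] by simp
    show ?case
    proof (cases "explores w t")
      case True
      have "num w (Suc t) = num w t + 1" using True by (simp add: num_def eps_def)
      then show ?thesis using explore[OF step.hyps(1) True] mono num_nonneg[of w T] by simp
    next
      case False
      have "num w (Suc t) = num w t" using False by (simp add: num_def eps_def)
      then show ?thesis using step.IH mono by simp
    qed
  qed
  note bound = this
  have "eventually (\<lambda>t::nat. a \<le> real t powr \<gamma> * ln (real t)) sequentially" for a
    using gamma by real_asymp
  from this[of "num w T + 1"]
  have "eventually (\<lambda>t. num w t \<le> (D + 1) * (real t powr \<gamma> * ln (real t))) sequentially"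
    using eventually_ge_at_top[of "max T 1"]
  proof eventually_elim
    case (elim t)
    then have "num w t \<le> num w T + 1 + D * (real t powr \<gamma> * ln (real t))"
      using bound[of t] by (auto simp: A_sched_def)
    then show ?case using elim by (simp add: algebra_simps)
  qed
  then show ?thesis using D by (intro exI[of _ "D + 1"]) auto
qed

definition noise_sum :: "(nat \<Rightarrow> real) \<Rightarrow> (nat \<Rightarrow> real) \<Rightarrow> nat \<Rightarrow> nat \<Rightarrow> real" where
  "noise_sum w e j t = (\<Sum>s<t. eps w s * (interior_ind (w (Suc s)) * feature (w (Suc s)) $ j) * e (Suc s))"

text \<open>For \<open>r = info *\<^sub>v err\<close> and the squared error \<open>E\<close>,
  excitation and Cauchy--Schwarz give \<open>c * N * E \<le> err \<bullet> r \<le> sqrt (E * (r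
  \<bullet> r))\<close>, hence \<open>E \<le> (r \<bullet> r) / (c * N)\<^sup>2\<close>. By
  \<open>noise_recursion\<close>, \<open>r\<close> is of order
  \<open>t powr (\<gamma>/2) * ln t\<close>, and its squared logarithm cancels against that of
  \<open>N\<^sup>2\<close>.\<close>

lemma err_bound:
  assumes ex: "excited w"
    and noise: "\<And>j. j < d \<Longrightarrow> \<exists>C. eventually (\<lambda>t. \<bar>noise_sum w e j t\<bar> \<le> C * (real t powr (\<gamma>/2) * ln (real t))) sequentially"
  shows "\<exists>K\<ge>0. eventually (\<lambda>t. err w e t \<bullet> err w e t \<le> K * real t powr (- \<gamma>)) sequentially"
proof -
  obtain c where c: "c > 0" "eventually (\<lambda>t. \<forall>v\<in>carrier_vec d. c * num w t * (v \<bullet> v) \<le> v \<bullet> (info w t *\<^sub>v v)) sequentially"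
    using ex by (auto simp: excited_def)
  obtain c' where c': "c' > 0" "eventually (\<lambda>t. c' * (real t powr \<gamma> * ln (real t)) \<le> num w t) sequentially"
    using num_lower by blast
  obtain C where C: "\<And>j. j < d \<Longrightarrow> eventually (\<lambda>t. \<bar>noise_sum w e j t\<bar> \<le> C j * (real t powr (\<gamma>/2) * ln (real t))) sequentially"
    using noise by metis
  define r0 where "r0 j = (mat_inv \<Sigma>0 *\<^sub>v (\<theta>0 - \<theta>s)) $ j" for j
  define K where "K = (\<Sum>j<d. \<bar>r0 j\<bar> + \<bar>C j\<bar>)"
  have "eventually (\<lambda>t. \<forall>j\<in>{..<d}. \<bar>noise_sum w e j t\<bar> \<le> C j * (real t powr (\<gamma>/2) * ln (real t))) sequentially"
    using C by (intro eventually_ball_finite) auto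
  moreover have "eventually (\<lambda>t::nat. 1 \<le> real t powr (\<gamma>/2) * ln (real t)) sequentially"
    using gamma by real_asymp
  ultimately have "eventually (\<lambda>t. err w e t \<bullet> err w e t \<le> real d * K\<^sup>2 / (c * c')\<^sup>2 * real t powr (- \<gamma>)) sequentially"
    using c(2) c'(2) eventually_ge_at_top[of 2]
  proof eventually_elim
    case (elim t)
    define y L where "y = real t powr (\<gamma>/2) * ln (real t)" and "L = ln (real t)"
    define u where "u = real t powr \<gamma>"
    have L: "L > 0" and u: "u > 0" using elim(5) by (auto simp: L_def u_def)
    have y2: "y\<^sup>2 = u * L\<^sup>2"
      using elim(5) by (simp add: y_def u_def L_def power_mult_distrib powr_power)
    define r where "r = info w t *\<^sub>v err w e t"
    have r: "r \<in> carrier_vec d" unfolding r_def by (rule mult_mat_vec_carrier[OF info_carrier err_carrier])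
    have rj: "(r $ j)\<^sup>2 \<le> (K * y)\<^sup>2" if j: "j < d" for j
    proof -
      have "\<bar>r $ j\<bar> \<le> \<bar>r0 j\<bar> + \<bar>noise_sum w e j t\<bar>"
        using noise_recursion[OF j, of w t e] by (simp add: r_def r0_def noise_sum_def)
      \<comment> \<open>The contribution of the initial error is constant in \<open>t\<close> and is
        absorbed because \<open>y \<ge> 1\<close> here.\<close>
      also have "\<dots> \<le> \<bar>r0 j\<bar> * y + \<bar>C j\<bar> * y"
      proof (rule add_mono)
        show "\<bar>r0 j\<bar> \<le> \<bar>r0 j\<bar> * y" using elim(2) by (simp add: y_def mult_le_cancel_left1)
        have "\<bar>noise_sum w e j t\<bar> \<le> C j * y" using elim(1) j by (auto simp: y_def)
        also have "\<dots> \<le> \<bar>C j\<bar> * y" using elim(2) by (intro mult_right_mono) (auto simp: y_def)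
        finally show "\<bar>noise_sum w e j t\<bar> \<le> \<bar>C j\<bar> * y" .
      qed
      also have "\<dots> = (\<bar>r0 j\<bar> + \<bar>C j\<bar>) * y" by (simp add: algebra_simps)
      also have "\<dots> \<le> K * y"
        unfolding K_def using elim(2) j by (intro mult_right_mono member_le_sum) (auto simp: y_def)
      finally show ?thesis by (metis abs_ge_zero power_mono power2_abs)
    qed
    have rr: "r \<bullet> r \<le> real d * (K * y)\<^sup>2"
    proof -
      have "r \<bullet> r = (\<Sum>j<d. (r $ j)\<^sup>2)"
        using r by (simp add: scalar_prod_def power2_eq_square atLeast0LessThan)
      also have "\<dots> \<le> (\<Sum>j<d. (K * y)\<^sup>2)" using rj by (intro sum_mono) auto
      finally show ?thesis by simp
    qed
    define E where "E = err w e t \<bullet> err w e t"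
    have E: "E \<ge> 0" by (simp add: E_def scalar_prod_self_nonneg)
    have cN: "c * c' * (u * L) \<le> c * num w t"
      using elim(4) c(1) by (simp add: u_def L_def mult.assoc)
    have pos: "0 < c * c' * (u * L)" using c c' u L by simp
    have "c * num w t * E \<le> err w e t \<bullet> r" using elim(3) by (simp add: E_def r_def)
    moreover have "0 \<le> c * num w t * E" using pos cN E by simp
    ultimately have "(c * num w t * E)\<^sup>2 \<le> (err w e t \<bullet> r)\<^sup>2" by (intro power_mono)
    also have "\<dots> \<le> E * (r \<bullet> r)" unfolding E_def by (rule scalar_prod_Cauchy_Schwarz[OF err_carrier r])
    finally have "E * ((c * num w t)\<^sup>2 * E) \<le> E * (r \<bullet> r)" by (simp add: power2_eq_square mult_ac)
    then have "(c * num w t)\<^sup>2 * E \<le> r \<bullet> r"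
      using E scalar_prod_self_nonneg[of r] by (cases "E = 0") (auto simp: mult_le_cancel_left)
    moreover have "(c * c' * (u * L))\<^sup>2 * E \<le> (c * num w t)\<^sup>2 * E"
      using cN pos E by (intro mult_right_mono power_mono) auto
    ultimately have "(c * c' * (u * L))\<^sup>2 * E \<le> real d * (K * y)\<^sup>2" using rr by linarith
    then have "E \<le> real d * (K * y)\<^sup>2 / (c * c' * (u * L))\<^sup>2"
      using pos by (subst pos_le_divide_eq) (auto simp: mult.commute)
    also have "\<dots> = real d * K\<^sup>2 / (c * c')\<^sup>2 * (1 / u)"
    proof -
      have "(K * y)\<^sup>2 = K\<^sup>2 * (u * L\<^sup>2)" by (simp add: power_mult_distrib y2)
      moreover have "(c * c' * (u * L))\<^sup>2 = (c * c')\<^sup>2 * (u * (u * L\<^sup>2))"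
        by (simp add: power_mult_distrib power2_eq_square)
      ultimately show ?thesis using u L c(1) c'(1) by simp
    qed
    also have "1 / u = real t powr (- \<gamma>)" by (simp add: u_def powr_minus_divide)
    finally show ?case by (simp add: E_def)
  qed
  then show ?thesis by (intro exI[of _ "real d * K\<^sup>2 / (c * c')\<^sup>2"]) simp
qed

abbreviation resp where "resp w e \<equiv> raid_x d lo hi \<theta>s \<Sigma>0 \<theta>0 xdes \<gamma> w e"

text \<open>The price \<open>- grad xdes\<close> would produce exactly \<open>xdes\<close>, and the
  exploitation price differs from it by \<open>err \<bullet> dPhi d xdes\<close> up to sign;
  \<open>br_Lipschitz\<close> and Cauchy--Schwarz finish that case. An exploration is charged the
  full length of the interval.\<close>

lemma response_error:
  "(resp w e (Suc s) - xdes)\<^sup>2 \<le> (hi - lo)\<^sup>2 * eps w s + (dPhi d xdes \<bullet> dPhi d xdes) / m\<^sup>2 * (err w e s \<bullet> err w e s)"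
proof (cases "explores w s")
  case True
  have "\<bar>resp w e (Suc s) - xdes\<bar> \<le> \<bar>hi - lo\<bar>"
    using br_in[of "price d xdes \<gamma> w (Suc s) (state w e s)"] xdes_interior
    unfolding raid_x_def by auto
  then have "(resp w e (Suc s) - xdes)\<^sup>2 \<le> (hi - lo)\<^sup>2" by (simp add: abs_le_square_iff)
  moreover have "0 \<le> (dPhi d xdes \<bullet> dPhi d xdes) / m\<^sup>2 * (err w e s \<bullet> err w e s)"
    using scalar_prod_self_nonneg by simp
  ultimately show ?thesis using True by (simp add: eps_def)
next
  case False
  define p where "p = - (snd (state w e s) \<bullet> dPhi d xdes)"
  have x: "resp w e (Suc s) = br p"
    using False by (simp add: raid_x_def price_def state_Sigma explores_def p_def)
  have "br (- grad xdes) = xdes" using xdes_interior by (intro br_eq_of_grad) auto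
  then have "\<bar>resp w e (Suc s) - xdes\<bar> \<le> \<bar>p + grad xdes\<bar> / m"
    using br_Lipschitz[of p "- grad xdes"] x by simp
  also have "p + grad xdes = - (err w e s \<bullet> dPhi d xdes)"
    using state_theta_carrier[of w e s] theta_carrier
    by (simp add: p_def grad_def err_def minus_scalar_prod_distrib[of _ d])
  finally have "(resp w e (Suc s) - xdes)\<^sup>2 \<le> (\<bar>err w e s \<bullet> dPhi d xdes\<bar> / m)\<^sup>2"
    using m_pos by (metis abs_ge_zero abs_minus_cancel power2_abs power_mono)
  also have "\<dots> = (err w e s \<bullet> dPhi d xdes)\<^sup>2 / m\<^sup>2" by (simp add: power_divide)
  also have "\<dots> \<le> (err w e s \<bullet> err w e s) * (dPhi d xdes \<bullet> dPhi d xdes) / m\<^sup>2"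
    by (intro divide_right_mono scalar_prod_Cauchy_Schwarz[of _ d]) auto
  finally show ?thesis using False by (simp add: eps_def mult.commute)
qed

lemma regret_bound:
  assumes ex: "excited w" and K: "K \<ge> 0"
    "eventually (\<lambda>t. err w e t \<bullet> err w e t \<le> K * real t powr (- \<gamma>)) sequentially"
  shows "(\<lambda>t. \<Sum>\<tau>=1..t. (resp w e \<tau> - xdes)\<^sup>2) \<in> O(\<lambda>t. real t powr \<gamma> * ln (real t))"
proof -
  obtain C where C: "C > 0" "eventually (\<lambda>t. num w t \<le> C * (real t powr \<gamma> * ln (real t))) sequentially"
    using num_upper[OF ex] by blast
  define L where "L = (dPhi d xdes \<bullet> dPhi d xdes) / m\<^sup>2"
  have L: "L \<ge> 0" unfolding L_def using scalar_prod_self_nonneg by simp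
  \<comment> \<open>As \<gamma> exceeds 1/2, the rate may be weakened: the partial sums of
    \<open>t powr (-1/2)\<close> are of order \<open>sqrt t\<close>, still negligible against
    \<open>t powr \<gamma> * ln t\<close>.\<close>
  have "eventually (\<lambda>t. err w e t \<bullet> err w e t \<le> K * real t powr (-1/2)) sequentially"
    using K(2) eventually_ge_at_top[of 1]
  proof eventually_elim
    case (elim t)
    have "real t powr (- \<gamma>) \<le> real t powr (-1/2)" using elim(2) gamma by (intro powr_mono) auto
    then have "K * real t powr (- \<gamma>) \<le> K * real t powr (-1/2)" using K(1) by (intro mult_left_mono)
    then show ?case using elim(1) by linarith
  qed
  from sum_le_sqrt_of_eventually[OF this K(1)]
  obtain C' where C': "\<And>t. (\<Sum>s<t. err w e s \<bullet> err w e s) \<le> C' + 2 * K * sqrt (real t)" by blast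
  have sum_le: "(\<Sum>\<tau>=1..t. (resp w e \<tau> - xdes)\<^sup>2) \<le> (hi - lo)\<^sup>2 * num w t + L * (C' + 2 * K * sqrt (real t))" for t
  proof -
    have "(\<Sum>\<tau>=1..t. (resp w e \<tau> - xdes)\<^sup>2) = (\<Sum>s<t. (resp w e (Suc s) - xdes)\<^sup>2)"
      by (simp add: sum.atLeast1_atMost_eq)
    also have "\<dots> \<le> (\<Sum>s<t. (hi - lo)\<^sup>2 * eps w s + L * (err w e s \<bullet> err w e s))"
      unfolding L_def by (intro sum_mono response_error)
    also have "\<dots> = (hi - lo)\<^sup>2 * num w t + L * (\<Sum>s<t. err w e s \<bullet> err w e s)"
      by (simp add: num_def sum.distrib sum_distrib_left)
    also have "\<dots> \<le> (hi - lo)\<^sup>2 * num w t + L * (C' + 2 * K * sqrt (real t))"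
      using C' L by (intro add_left_mono mult_left_mono)
    finally show ?thesis .
  qed
  have "eventually (\<lambda>t::nat. L * (C' + 2 * K * sqrt (real t)) \<le> 1 * (real t powr \<gamma> * ln (real t))) sequentially"
  proof -
    have "(\<lambda>t::nat. L * (C' + 2 * K * sqrt (real t))) \<in> o(\<lambda>t. real t powr \<gamma> * ln (real t))"
      using gamma by real_asymp
    then have "eventually (\<lambda>t::nat. norm (L * (C' + 2 * K * sqrt (real t))) \<le>
        1 * norm (real t powr \<gamma> * ln (real t))) sequentially"
      by (rule landau_o.smallD) simp
    then show ?thesis using eventually_ge_at_top[of 1]
      by eventually_elim simp
  qed
  then have "eventually (\<lambda>t. norm (\<Sum>\<tau>=1..t. (resp w e \<tau> - xdes)\<^sup>2) \<le>
      ((hi - lo)\<^sup>2 * C + 1) * norm (real t powr \<gamma> * ln (real t))) sequentially"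
    using C(2) eventually_ge_at_top[of 1]
  proof eventually_elim
    case (elim t)
    have "(\<Sum>\<tau>=1..t. (resp w e \<tau> - xdes)\<^sup>2) \<le>
        (hi - lo)\<^sup>2 * (C * (real t powr \<gamma> * ln (real t))) + 1 * (real t powr \<gamma> * ln (real t))"
      using sum_le[of t] mult_left_mono[OF elim(2), of "(hi - lo)\<^sup>2"] elim(1) by simp
    then show ?case using elim(3) by (simp add: sum_nonneg algebra_simps)
  qed
  then show ?thesis by (rule bigoI)
qed

end

section \<open>The expected information matrix\<close>

text \<open>\<open>dPhi d x \<bullet> v\<close> is a polynomial in \<open>x\<close> whose
  coefficients are the entries of \<open>v\<close> scaled by \<open>k + 1\<close>, hence nonzero
  when \<open>v\<close> is.\<close>

lemma finite_roots_dPhi: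
  fixes v :: "real vec"
  assumes v: "v \<in> carrier_vec d" "v \<noteq> 0\<^sub>v d"
  shows "finite {x. dPhi d x \<bullet> v = 0}"
proof -
  define q where "q = (\<Sum>k<d. monom (real (k + 1) * v $ k) k)"
  have "poly q x = dPhi d x \<bullet> v" for x
    using v by (simp add: q_def poly_sum poly_monom scalar_prod_def dPhi_def atLeast0LessThan mult_ac)
  moreover have "q \<noteq> 0"
  proof
    assume "q = 0"
    have "v $ j = 0" if "j < d" for j
    proof -
      have "coeff q j = (\<Sum>k<d. if k = j then real (k + 1) * v $ k else 0)"
        unfolding q_def coeff_sum coeff_monom ..
      also have "\<dots> = real (j + 1) * v $ j" using that by (simp add: sum.delta)
      finally show ?thesis using \<open>q = 0\<close> by simp
    qed
    then have "v = 0\<^sub>v d" using v by (intro eq_vecI) auto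
    with v show False by simp
  qed
  ultimately show ?thesis using poly_roots_finite[of q] by simp
qed

definition gauss :: "real \<Rightarrow> real measure" where
  "gauss \<sigma> = density lborel (\<lambda>p. ennreal (normal_density 0 \<sigma> p))"

context raid
begin

text \<open>The maximum with 1 makes powers of the radius increase with the exponent, so that one
  bound serves all coordinates.\<close>

definition feature_bound :: real where
  "feature_bound = real d * (max 1 (max \<bar>lo\<bar> \<bar>hi\<bar>)) ^ d"

lemma feature_bound_ge_1: "1 \<le> feature_bound"
proof -
  have "1 * 1 \<le> real d * (max 1 (max \<bar>lo\<bar> \<bar>hi\<bar>)) ^ d"
    using d_pos by (intro mult_mono one_le_power) auto
  then show ?thesis by (simp add: feature_bound_def)
qed

lemma feature_index: "j < d \<Longrightarrow> feature p $ j = real (j + 1) * br p ^ j"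
  by (simp add: feature_def dPhi_def)

lemma feature_abs_le:
  assumes j: "j < d" shows "\<bar>feature p $ j\<bar> \<le> feature_bound"
proof -
  define R where "R = max 1 (max \<bar>lo\<bar> \<bar>hi\<bar>)"
  have "\<bar>br p\<bar> \<le> R" using br_in[of p] by (auto simp: R_def)
  then have "\<bar>br p\<bar> ^ j \<le> R ^ j" by (intro power_mono) auto
  also have "\<dots> \<le> R ^ d" using j by (intro power_increasing) (auto simp: R_def)
  finally have "real (j + 1) * \<bar>br p\<bar> ^ j \<le> real d * R ^ d"
    using j by (intro mult_mono) (auto simp: R_def)
  then show ?thesis using j by (simp add: feature_index abs_mult power_abs feature_bound_def R_def)
qed

lemma borel_measurable_feature [measurable]:
  "j < d \<Longrightarrow> (\<lambda>p. feature p $ j) \<in> borel_measurable borel"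
  by (simp add: feature_index)

lemma borel_measurable_interior_ind [measurable]: "interior_ind \<in> borel_measurable borel"
  unfolding interior_ind_def by measurable

definition psi :: "nat \<Rightarrow> nat \<Rightarrow> real \<Rightarrow> real" where
  "psi j k p = interior_ind p * feature p $ j * feature p $ k"

lemma borel_measurable_psi [measurable]:
  "j < d \<Longrightarrow> k < d \<Longrightarrow> psi j k \<in> borel_measurable borel"
  unfolding psi_def by measurable

lemma psi_abs_le: "j < d \<Longrightarrow> k < d \<Longrightarrow> \<bar>psi j k p\<bar> \<le> feature_bound\<^sup>2"
proof -
  assume jk: "j < d" "k < d"
  have "\<bar>psi j k p\<bar> \<le> 1 * feature_bound * feature_bound"
    unfolding psi_def abs_mult using jk interior_ind_range[of p] feature_bound_ge_1
    by (intro mult_mono feature_abs_le) auto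
  then show ?thesis by (simp add: power2_eq_square)
qed

lemma info_entry_psi:
  "j < d \<Longrightarrow> k < d \<Longrightarrow>
   info w t $$ (j,k) = mat_inv \<Sigma>0 $$ (j,k) + (\<Sum>s<t. eps w s * psi j k (w (Suc s)))"
  by (simp add: info_entry psi_def)

lemma measurable_eps_of_info:
  assumes "\<And>j k. j < d \<Longrightarrow> k < d \<Longrightarrow> (\<lambda>\<omega>. info (W \<omega>) t $$ (j,k)) \<in> borel_measurable N"
  shows "(\<lambda>\<omega>. eps (W \<omega>) t) \<in> borel_measurable N"
proof -
  have [measurable]: "(\<lambda>\<omega>. mat_trace (mat_inv (info (W \<omega>) t))) \<in> borel_measurable N"
    by (rule borel_measurable_trace_inverse[OF pos_def_info assms])
  show ?thesis unfolding eps_def explores_def explore_def by measurable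
qed

text \<open>The dependence alternates: \<open>eps\<close> at \<open>t\<close> is a function of
  \<open>info\<close> at \<open>t\<close>, which uses \<open>eps\<close> and the draw of the
  preceding step. Only draws up to time \<open>t\<close> enter, so \<open>eps\<close> at
  \<open>t\<close> is predictable relative to the draw at \<open>Suc t\<close> that it
  multiplies.\<close>

lemma measurable_info:
  assumes "\<And>r. r \<le> t \<Longrightarrow> (\<lambda>\<omega>. W \<omega> r) \<in> borel_measurable N"
  shows "j < d \<Longrightarrow> k < d \<Longrightarrow> (\<lambda>\<omega>. info (W \<omega>) t $$ (j,k)) \<in> borel_measurable N"
  using assms
proof (induction t arbitrary: j k)
  case (Suc t)
  have [measurable]: "(\<lambda>\<omega>. eps (W \<omega>) t) \<in> borel_measurable N"
    using Suc by (intro measurable_eps_of_info) auto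
  have [measurable]: "(\<lambda>\<omega>. info (W \<omega>) t $$ (j,k)) \<in> borel_measurable N" using Suc by auto
  have [measurable]: "(\<lambda>\<omega>. W \<omega> (Suc t)) \<in> borel_measurable N" using Suc by auto
  have [measurable]: "psi j k \<in> borel_measurable borel" using Suc by simp
  have "(\<lambda>\<omega>. info (W \<omega>) (Suc t) $$ (j,k)) = (\<lambda>\<omega>. info (W \<omega>) t $$ (j,k) + eps (W \<omega>) t * psi j k (W \<omega> (Suc t)))"
    using Suc.prems(1,2) by (simp add: info_entry_psi add.assoc del: info.simps)
  then show ?case by (simp del: info.simps)
qed simp

lemma measurable_eps:
  assumes "\<And>r. r \<le> t \<Longrightarrow> (\<lambda>\<omega>. W \<omega> r) \<in> borel_measurable N"
  shows "(\<lambda>\<omega>. eps (W \<omega>) t) \<in> borel_measurable N"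
  using assms by (intro measurable_eps_of_info measurable_info)

definition fisher :: "real \<Rightarrow> real mat" where
  "fisher \<sigma> = mat d d (\<lambda>(j,k). \<integral>p. psi j k p \<partial>gauss \<sigma>)"

text \<open>The form at \<open>v\<close> is the mean of the nonnegative \<open>h\<close>. If it
  vanished, almost every price between \<open>- grad hi\<close> and \<open>- grad lo\<close> would
  have its response among the finitely many roots of \<open>dPhi d x \<bullet> v\<close>. An
  interior response \<open>x\<close> comes only from the price \<open>- grad x\<close>, so this
  interval of positive length would be null.\<close>

lemma pos_def_fisher:
  assumes \<sigma>: "\<sigma> > 0" shows "pos_def d (fisher \<sigma>)"
proof -
  interpret G: prob_space "gauss \<sigma>" unfolding gauss_def by (rule prob_space_normal_density[OF \<sigma>])
  have sets: "sets (gauss \<sigma>) = sets borel" by (simp add: gauss_def)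
  have meas: "f \<in> borel_measurable (gauss \<sigma>)" if "f \<in> borel_measurable borel" for f :: "real \<Rightarrow> real"
    using that by (simp add: gauss_def)
  have int: "integrable (gauss \<sigma>) (psi j k)" if "j < d" "k < d" for j k
    using that psi_abs_le by (intro G.integrable_const_bound[where B = "feature_bound\<^sup>2"] meas) auto
  have "v \<bullet> (fisher \<sigma> *\<^sub>v v) > 0" if v: "v \<in> carrier_vec d" "v \<noteq> 0\<^sub>v d" for v
  proof (rule ccontr)
    assume neg: "\<not> v \<bullet> (fisher \<sigma> *\<^sub>v v) > 0"
    define h where "h p = interior_ind p * (feature p \<bullet> v)\<^sup>2" for p
    have h: "h p = (\<Sum>j<d. \<Sum>k<d. v $ j * v $ k * psi j k p)" for p
      using v by (simp add: h_def psi_def scalar_prod_def atLeast0LessThan power2_eq_square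
          sum_product sum_distrib_left mult_ac)
    have hint: "integrable (gauss \<sigma>) h"
      unfolding h using int by (intro Bochner_Integration.integrable_sum integrable_mult_right) auto
    have "v \<bullet> (fisher \<sigma> *\<^sub>v v) = (\<Sum>j<d. \<Sum>k<d. v $ j * v $ k * (\<integral>p. psi j k p \<partial>gauss \<sigma>))"
      using v by (subst quad_sum) (auto simp: fisher_def intro!: sum.cong)
    also have "\<dots> = (\<integral>p. h p \<partial>gauss \<sigma>)"
    proof -
      have "(\<integral>p. h p \<partial>gauss \<sigma>) = (\<Sum>j<d. \<integral>p. (\<Sum>k<d. v $ j * v $ k * psi j k p) \<partial>gauss \<sigma>)"
        unfolding h using int
        by (intro Bochner_Integration.integral_sum Bochner_Integration.integrable_sum integrable_mult_right) auto
      also have "\<dots> = (\<Sum>j<d. \<Sum>k<d. \<integral>p. v $ j * v $ k * psi j k p \<partial>gauss \<sigma>)"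
        using int by (intro sum.cong Bochner_Integration.integral_sum integrable_mult_right) auto
      finally show ?thesis by simp
    qed
    finally have "(\<integral>p. h p \<partial>gauss \<sigma>) \<le> 0" using neg by simp
    moreover have hn: "h p \<ge> 0" for p by (simp add: h_def interior_ind_range)
    ultimately have "(\<integral>p. h p \<partial>gauss \<sigma>) = 0"
      by (intro antisym Bochner_Integration.integral_nonneg) auto
    then have "AE p in gauss \<sigma>. h p = 0"
      using integral_nonneg_eq_0_iff_AE[OF hint] hn by simp
    then have AE0: "AE p in lborel. h p = 0"
      unfolding gauss_def using normal_density_pos[OF \<sigma>] by (subst (asm) AE_density) auto
    define F where "F = (\<lambda>x. - grad x) ` {x. dPhi d x \<bullet> v = 0}"
    have "F \<in> null_sets lborel"
      unfolding F_def by (intro finite_imp_null_set_lborel finite_imageI finite_roots_dPhi v)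
    then have "AE p in lborel. p \<notin> F" by (rule AE_not_in)
    with AE0 have "AE p in lborel. p \<notin> {- grad hi <..< - grad lo}"
    proof eventually_elim
      case (elim p)
      show ?case
      proof
        assume "p \<in> {- grad hi <..< - grad lo}"
        then have int: "lo < br p \<and> br p < hi" using br_interior_iff[of p] by auto
        then have "feature p \<bullet> v = 0" using elim(1) by (simp add: h_def interior_ind_def)
        moreover have "p = - grad (br p)" using grad_br_interior int by simp
        ultimately show False using elim(2) by (auto simp: F_def feature_def)
      qed
    qed
    then have "{- grad hi <..< - grad lo} \<in> null_sets lborel"
      by (subst AE_iff_null_sets) auto
    then have "emeasure lborel {- grad hi <..< - grad lo} = 0" by (rule null_setsD1)
    moreover have "grad lo < grad hi" using grad_strict_mono lo_less_hi by simp
    ultimately show False by simp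
  qed
  moreover have "transpose_mat (fisher \<sigma>) = fisher \<sigma>"
    by (intro eq_matI) (auto simp: fisher_def psi_def mult_ac)
  ultimately show ?thesis by (simp add: pos_def_def fisher_def)
qed

end

section \<open>Almost sure behaviour\<close>

context raid
begin

text \<open>Each exploration raises \<open>num\<close> by one, so along the exploration times the
  summands run through an initial segment of a convergent series. The bound is the same for every
  sample path.\<close>

lemma sum_eps_powr_le:
  assumes "q > 1"
  shows "(\<Sum>s<t. eps w s * num w (Suc s) powr (- q)) \<le> (\<Sum>k. real (Suc k) powr (- q))"
proof -
  have "\<exists>n::nat. num w t = real n \<and> (\<Sum>s<t. eps w s * num w (Suc s) powr (- q)) = (\<Sum>k<n. real (Suc k) powr (- q))"
  proof (induction t)
    case 0
    show ?case by (intro exI[of _ 0]) (simp add: num_def)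
  next
    case (Suc t)
    then obtain n where n: "num w t = real n"
      "(\<Sum>s<t. eps w s * num w (Suc s) powr (- q)) = (\<Sum>k<n. real (Suc k) powr (- q))" by blast
    show ?case
    proof (cases "explores w t")
      case True
      have "num w (Suc t) = real (Suc n)" using True n(1) by (simp add: num_def eps_def)
      then show ?thesis using True n(2) by (intro exI[of _ "Suc n"]) (simp add: eps_def)
    next
      case False
      have "num w (Suc t) = real n" using False n(1) by (simp add: num_def eps_def)
      then show ?thesis using False n(2) by (intro exI[of _ n]) (simp add: eps_def)
    qed
  qed
  then obtain n where n: "(\<Sum>s<t. eps w s * num w (Suc s) powr (- q)) = (\<Sum>k<n. real (Suc k) powr (- q))"
    by blast
  have "summable (\<lambda>k. real (Suc k) powr (- q))"
    using assms summable_Suc_iff[of "\<lambda>k. real k powr (- q)"] summable_real_powr_iff[of "- q"] by simp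
  then show ?thesis unfolding n by (intro sum_le_suminf) auto
qed

end

text \<open>The index type \<open>nat + nat\<close> puts noise (\<open>Inl\<close>) and probing
  draws (\<open>Inr\<close>) into one independent family, so that a history can mix both.\<close>

locale raid_prob = prob_space M + raid d lo hi m Mx \<theta>s \<Sigma>0 \<theta>0 xdes \<gamma>
  for M :: "'w measure" and d :: nat and lo hi m Mx :: real and \<theta>s :: "real vec"
    and \<Sigma>0 :: "real mat" and \<theta>0 :: "real vec" and xdes \<gamma> :: real +
  fixes e w :: "nat \<Rightarrow> 'w \<Rightarrow> real" and \<sigma> a C :: real
  assumes sigma_pos: "\<sigma> > 0" and a_gt_2: "a > 2" and C_nonneg: "C \<ge> 0"
    and noise_int: "\<And>t. integrable M (e t)" and noise_mean: "\<And>t. expectation (e t) = 0"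
    and noise_moment: "\<And>t. (\<integral>\<^sup>+ \<omega>. ennreal (\<bar>e t \<omega>\<bar> powr a) \<partial>M) \<le> ennreal C"
    and probing: "\<And>t. distributed M lborel (w t) (normal_density 0 \<sigma>)"
    and indep_all: "indep_vars (\<lambda>_. borel) (case_sum e w) UNIV"
begin

definition probe :: "'w \<Rightarrow> nat \<Rightarrow> real" where "probe \<omega> = (\<lambda>t. w t \<omega>)"

definition noise :: "'w \<Rightarrow> nat \<Rightarrow> real" where "noise \<omega> = (\<lambda>t. e t \<omega>)"

lemma e_meas [measurable]: "e t \<in> borel_measurable M"
  using noise_int by auto

lemma w_meas [measurable]: "w t \<in> borel_measurable M"
  using distributed_measurable[OF probing[of t]] by simp

lemma expectation_probe:
  fixes f :: "real \<Rightarrow> real"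
  assumes "f \<in> borel_measurable borel"
  shows "expectation (\<lambda>\<omega>. f (w t \<omega>)) = (\<integral>p. f p \<partial>gauss \<sigma>)"
proof -
  have "gauss \<sigma> = distr M lborel (w t)"
    unfolding gauss_def using distributed_distr_eq_density[OF probing[of t]] by simp
  then show ?thesis using assms by (simp add: integral_distr)
qed

text \<open>A law of large numbers with predictable weights. The variables are bounded, so a
  constant scale \<open>l\<close> keeps clipping inactive; the deviation is at most
  \<open>2 * B\<^sup>2 * l * N + 2 * ln t / l\<close>, and the logarithm is negligible against
  \<open>N\<close> by \<open>num_lower\<close>.\<close>

lemma AE_psi_average:
  assumes jk: "j < d" "k < d" and \<eta>: "\<eta> > 0"
  shows "AE \<omega> in M. eventually (\<lambda>t. \<bar>\<Sum>s<t. eps (probe \<omega>) s * (psi j k (w (Suc s) \<omega>) - fisher \<sigma> $$ (j,k))\<bar>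
    \<le> \<eta> * num (probe \<omega>) t) sequentially"
proof -
  define q where "q = fisher \<sigma> $$ (j,k)"
  have q: "q = expectation (\<lambda>\<omega>. psi j k (w t \<omega>))" for t
    using jk by (simp add: q_def fisher_def expectation_probe)
  define B where "B = 2 * feature_bound\<^sup>2"
  have B: "B \<ge> 1" using one_le_power[OF feature_bound_ge_1, of 2] by (simp add: B_def)
  have [measurable]: "psi j k \<in> borel_measurable borel" using jk by simp
  have psi_int: "integrable M (\<lambda>\<omega>. psi j k (w t \<omega>))" for t
    using jk psi_abs_le by (intro integrable_const_bound[where B = "feature_bound\<^sup>2"]) auto
  have "\<bar>q\<bar> \<le> feature_bound\<^sup>2"
  proof -
    have "\<bar>q\<bar> \<le> expectation (\<lambda>\<omega>. \<bar>psi j k (w 0 \<omega>)\<bar>)" unfolding q[of 0] by (rule integral_abs_bound)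
    also have "\<dots> \<le> feature_bound\<^sup>2"
      using psi_int[of 0] psi_abs_le jk by (intro integral_le_const) auto
    finally show ?thesis .
  qed
  then have Yb: "\<bar>psi j k p - q\<bar> \<le> B" for p
    using psi_abs_le[OF jk, of p] by (simp add: B_def)
  then have Yb2: "(psi j k p - q)\<^sup>2 \<le> B\<^sup>2" for p
    by (metis abs_ge_zero power2_abs power_mono)
  interpret I: innovations M "\<lambda>s. hist (case_sum e w) (Inr ` {..s})" "\<lambda>s \<omega>. psi j k (w (Suc s) \<omega>) - q" "B\<^sup>2"
  proof
    fix s
    show "indep_of (hist (case_sum e w) (Inr ` {..s})) (\<lambda>\<omega>. psi j k (w (Suc s) \<omega>) - q)"
    proof -
      have "Inr (Suc s) \<notin> (Inr ` {..s} :: (nat + nat) set)" by auto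
      from indep_of_hist[OF indep_all this, of "\<lambda>p. psi j k p - q"] show ?thesis by simp
    qed
    show "sets (hist (case_sum e w) (Inr ` {..s})) \<subseteq> sets (hist (case_sum e w) (Inr ` {..Suc s}))"
      by (intro sets_hist_mono) auto
    have "w (Suc s) \<in> borel_measurable (hist (case_sum e w) (Inr ` {..Suc s}))"
      using measurable_hist_component[of "Inr (Suc s)" "Inr ` {..Suc s}" "case_sum e w"] by simp
    then show "(\<lambda>\<omega>. psi j k (w (Suc s) \<omega>) - q) \<in> borel_measurable (hist (case_sum e w) (Inr ` {..Suc s}))"
      by measurable
    show "integrable M (\<lambda>\<omega>. psi j k (w (Suc s) \<omega>) - q)" using psi_int by simp
    show "expectation (\<lambda>\<omega>. psi j k (w (Suc s) \<omega>) - q) = 0"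
      using psi_int q[of "Suc s"] by (simp add: prob_space)
    show i2: "integrable M (\<lambda>\<omega>. (psi j k (w (Suc s) \<omega>) - q)\<^sup>2)"
      using Yb2 by (intro integrable_const_bound[where B = "B\<^sup>2"]) auto
    show "expectation (\<lambda>\<omega>. (psi j k (w (Suc s) \<omega>) - q)\<^sup>2) \<le> B\<^sup>2"
      using Yb2 i2 by (intro integral_le_const) auto
  qed simp
  \<comment> \<open>The first bound makes clipping inactive; the second lets the compensator use at
    most half of \<open>\<eta> * N\<close>, leaving the other half for the logarithm.\<close>
  define l where "l = min (1 / B) (\<eta> / (4 * B\<^sup>2))"
  have l: "l > 0" "l * B \<le> 1" "2 * B\<^sup>2 * l \<le> \<eta> / 2"
  proof -
    show "l > 0" using B \<eta> by (simp add: l_def)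
    have "l \<le> 1 / B" by (simp add: l_def)
    then show "l * B \<le> 1" using B by (simp add: field_simps)
    have "l \<le> \<eta> / (4 * B\<^sup>2)" by (simp add: l_def)
    then show "2 * B\<^sup>2 * l \<le> \<eta> / 2" using B by (simp add: field_simps)
  qed
  have "(\<lambda>\<omega>. eps (probe \<omega>) s) \<in> borel_measurable (hist (case_sum e w) (Inr ` {..s}))" for s
  proof (rule measurable_eps)
    fix r assume "r \<le> s"
    then show "(\<lambda>\<omega>. probe \<omega> r) \<in> borel_measurable (hist (case_sum e w) (Inr ` {..s}))"
      using measurable_hist_component[of "Inr r" "Inr ` {..s}" "case_sum e w"] by (simp add: probe_def)
  qed
  from I.AE_clipped_sum_abs_le[of "\<lambda>s \<omega>. eps (probe \<omega>) s" "\<lambda>_. l", OF this]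
  show ?thesis
  proof (rule AE_mp, intro AE_I2 impI)
    fix \<omega>
    define Y where "Y s = eps (probe \<omega>) s * (psi j k (w (Suc s) \<omega>) - q)" for s
    assume ev: "eventually (\<lambda>t. \<bar>\<Sum>s<t. clip (l * (eps (probe \<omega>) s * (psi j k (w (Suc s) \<omega>) - q)))\<bar>
      \<le> 2 * B\<^sup>2 * l\<^sup>2 * (\<Sum>s<t. (eps (probe \<omega>) s)\<^sup>2) + 2 * ln (real t)) sequentially"
    have clip: "clip (l * Y s) = l * Y s" for s
    proof -
      have "\<bar>l * Y s\<bar> = l * (eps (probe \<omega>) s * \<bar>psi j k (w (Suc s) \<omega>) - q\<bar>)"
        using l(1) eps_range[of "probe \<omega>" s] by (simp add: Y_def abs_mult)
      also have "\<dots> \<le> l * (1 * B)"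
        using l(1) Yb eps_range[of "probe \<omega>" s] by (intro mult_left_mono mult_mono) auto
      finally show ?thesis using l(2) by (simp add: clip_def)
    qed
    obtain c where c: "c > 0" "eventually (\<lambda>t. c * (real t powr \<gamma> * ln (real t)) \<le> num (probe \<omega>) t) sequentially"
      using num_lower by blast
    have "eventually (\<lambda>t::nat. x \<le> real t powr \<gamma>) sequentially" for x :: real using gamma by real_asymp
    \<comment> \<open>This threshold yields \<open>4 * ln t \<le> l * \<eta> * N\<close> through the
      lower bound on \<open>N\<close>.\<close>
    from ev c(2) this[of "4 / (l * \<eta> * c)"] eventually_ge_at_top[of 1]
    show "eventually (\<lambda>t. \<bar>\<Sum>s<t. eps (probe \<omega>) s * (psi j k (w (Suc s) \<omega>) - fisher \<sigma> $$ (j,k))\<bar>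
      \<le> \<eta> * num (probe \<omega>) t) sequentially"
    proof eventually_elim
      case (elim t)
      define N where "N = num (probe \<omega>) t"
      have "l * \<bar>\<Sum>s<t. Y s\<bar> = \<bar>\<Sum>s<t. clip (l * Y s)\<bar>"
        using l(1) by (simp add: clip sum_distrib_left[symmetric] abs_mult)
      also have "\<dots> \<le> 2 * B\<^sup>2 * l\<^sup>2 * N + 2 * ln (real t)"
        using elim(1) by (simp add: Y_def eps_range N_def num_def)
      also have "2 * B\<^sup>2 * l\<^sup>2 * N = l * ((2 * B\<^sup>2 * l) * N)" by (simp add: power2_eq_square)
      also have "\<dots> \<le> l * (\<eta> / 2 * N)"
        using l num_nonneg[of "probe \<omega>" t] by (intro mult_left_mono mult_right_mono) (auto simp: N_def)
      also have "2 * ln (real t) \<le> l * (\<eta> / 2 * N)"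
      proof -
        have "4 \<le> real t powr \<gamma> * (l * \<eta> * c)" using elim(3) l(1) \<eta> c(1) by (simp add: field_simps)
        then have "4 * ln (real t) \<le> real t powr \<gamma> * (l * \<eta> * c) * ln (real t)"
          using elim(4) by (intro mult_right_mono) auto
        also have "\<dots> = l * \<eta> * (c * (real t powr \<gamma> * ln (real t)))" by simp
        also have "\<dots> \<le> l * \<eta> * N" using elim(2) l(1) \<eta> by (intro mult_left_mono) (auto simp: N_def)
        finally show ?thesis by simp
      qed
      finally have "l * \<bar>\<Sum>s<t. Y s\<bar> \<le> l * (\<eta> * N)" by (simp add: algebra_simps)
      then show ?case using l(1) by (simp add: Y_def q_def N_def)
    qed
  qed
qed

text \<open>Entrywise averages suffice: errors of at most \<open>\<eta> * N\<close> in each of the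
  finitely many entries perturb the form by at most \<open>\<eta> * N * d * (v \<bullet> v)\<close>,
  uniformly in \<open>v\<close>. The initial matrix only adds a nonnegative form.\<close>

lemma AE_excited: "AE \<omega> in M. excited (probe \<omega>)"
proof -
  have F: "pos_def d (fisher \<sigma>)" by (rule pos_def_fisher[OF sigma_pos])
  have Fc: "fisher \<sigma> \<in> carrier_mat d d" using F by (simp add: pos_def_def)
  define T where "T = mat_trace (mat_inv (fisher \<sigma>))"
  have low: "v \<bullet> v \<le> T * (v \<bullet> (fisher \<sigma> *\<^sub>v v))" if "v \<in> carrier_vec d" for v
    unfolding T_def by (rule sq_norm_le_trace_inverse[OF F that])
  have T: "T > 0"
  proof (rule ccontr)
    assume "\<not> T > 0"
    moreover have "unit_vec d 0 \<bullet> (fisher \<sigma> *\<^sub>v unit_vec d 0) > 0"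
      using F d_pos unit_vec_nonzero[OF d_pos] by (simp add: pos_def_def)
    ultimately have "T * (unit_vec d 0 \<bullet> (fisher \<sigma> *\<^sub>v unit_vec d 0)) \<le> 0"
      by (simp add: mult_nonpos_nonneg)
    with low[of "unit_vec d 0"] d_pos show False by simp
  qed
  \<comment> \<open>With this value the perturbation is half of
    \<open>N * (v \<bullet> v) / T\<close>, the lower bound for the expected form.\<close>
  define \<eta> where "\<eta> = 1 / (2 * T * real d)"
  have \<eta>: "\<eta> > 0" using T d_pos by (simp add: \<eta>_def)
  have "AE \<omega> in M. \<forall>jk\<in>{..<d} \<times> {..<d}. eventually (\<lambda>t. \<bar>\<Sum>s<t. eps (probe \<omega>) s * (psi (fst jk) (snd jk) (w (Suc s) \<omega>) - fisher \<sigma> $$ (fst jk, snd jk))\<bar>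
    \<le> \<eta> * num (probe \<omega>) t) sequentially"
    using AE_psi_average[OF _ _ \<eta>] by (intro AE_finite_allI) auto
  then show ?thesis
  proof (rule AE_mp, intro AE_I2 impI)
    fix \<omega> assume "\<forall>jk\<in>{..<d} \<times> {..<d}. eventually (\<lambda>t. \<bar>\<Sum>s<t. eps (probe \<omega>) s * (psi (fst jk) (snd jk) (w (Suc s) \<omega>) - fisher \<sigma> $$ (fst jk, snd jk))\<bar>
      \<le> \<eta> * num (probe \<omega>) t) sequentially"
    then have "eventually (\<lambda>t. \<forall>jk\<in>{..<d} \<times> {..<d}. \<bar>\<Sum>s<t. eps (probe \<omega>) s * (psi (fst jk) (snd jk) (w (Suc s) \<omega>) - fisher \<sigma> $$ (fst jk, snd jk))\<bar>
      \<le> \<eta> * num (probe \<omega>) t) sequentially"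
      by (intro eventually_ball_finite) auto
    then have "eventually (\<lambda>t. \<forall>v\<in>carrier_vec d. 1 / (2 * T) * num (probe \<omega>) t * (v \<bullet> v)
        \<le> v \<bullet> (info (probe \<omega>) t *\<^sub>v v)) sequentially"
    proof eventually_elim
      case (elim t)
      show ?case
      proof
        fix v :: "real vec" assume v: "v \<in> carrier_vec d"
        define N where "N = num (probe \<omega>) t"
        define S where "S j k = (\<Sum>s<t. eps (probe \<omega>) s * psi j k (w (Suc s) \<omega>))" for j k
        have N: "N \<ge> 0" by (simp add: N_def num_nonneg)
        have S: "\<bar>S j k - N * fisher \<sigma> $$ (j,k)\<bar> \<le> \<eta> * N" if "j < d" "k < d" for j k
        proof -
          have "S j k - N * fisher \<sigma> $$ (j,k) = (\<Sum>s<t. eps (probe \<omega>) s * (psi j k (w (Suc s) \<omega>) - fisher \<sigma> $$ (j,k)))"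
            by (simp add: S_def N_def num_def right_diff_distrib sum_subtractf sum_distrib_right)
          then show ?thesis using elim that by (force simp: N_def)
        qed
        have vv: "v \<bullet> v = (\<Sum>j<d. (v $ j)\<^sup>2)"
          using v by (simp add: scalar_prod_def power2_eq_square atLeast0LessThan)
        have P0: "v \<bullet> (mat_inv \<Sigma>0 *\<^sub>v v) \<ge> 0"
          using pos_def_mat_inv[OF Sigma0] v by (cases "v = 0\<^sub>v d") (auto simp: pos_def_def less_imp_le)
        have P0c: "mat_inv \<Sigma>0 \<in> carrier_mat d d" by (rule pos_def_inverse(1)[OF Sigma0])
        have "v \<bullet> (info (probe \<omega>) t *\<^sub>v v) = (\<Sum>j<d. \<Sum>k<d. v $ j * v $ k * (mat_inv \<Sigma>0 $$ (j,k) + S j k))"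
          unfolding quad_sum[OF info_carrier v]
          by (intro sum.cong refl) (simp add: info_entry_psi S_def probe_def)
        also have "\<dots> = v \<bullet> (mat_inv \<Sigma>0 *\<^sub>v v) + (\<Sum>j<d. \<Sum>k<d. v $ j * v $ k * S j k)"
          unfolding quad_sum[OF P0c v] by (simp add: sum.distrib algebra_simps)
        finally have e1: "v \<bullet> (info (probe \<omega>) t *\<^sub>v v) \<ge> (\<Sum>j<d. \<Sum>k<d. v $ j * v $ k * S j k)" using P0 by simp
        have "(\<Sum>j<d. \<Sum>k<d. v $ j * v $ k * S j k) \<ge>
            (\<Sum>j<d. \<Sum>k<d. v $ j * v $ k * (N * fisher \<sigma> $$ (j,k)) - \<eta> * N * (\<bar>v $ j\<bar> * \<bar>v $ k\<bar>))"
        proof (intro sum_mono)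
          fix j k assume jk: "j \<in> {..<d}" "k \<in> {..<d}"
          have "\<bar>v $ j * v $ k * (S j k - N * fisher \<sigma> $$ (j,k))\<bar> \<le> (\<bar>v $ j\<bar> * \<bar>v $ k\<bar>) * (\<eta> * N)"
            unfolding abs_mult using S jk by (intro mult_left_mono) auto
          then have "- ((\<bar>v $ j\<bar> * \<bar>v $ k\<bar>) * (\<eta> * N)) \<le> v $ j * v $ k * (S j k - N * fisher \<sigma> $$ (j,k))"
            by linarith
          then show "v $ j * v $ k * (N * fisher \<sigma> $$ (j,k)) - \<eta> * N * (\<bar>v $ j\<bar> * \<bar>v $ k\<bar>) \<le> v $ j * v $ k * S j k"
            by (simp add: algebra_simps)
        qed
        moreover have "(\<Sum>j<d. \<Sum>k<d. v $ j * v $ k * (N * fisher \<sigma> $$ (j,k)) - \<eta> * N * (\<bar>v $ j\<bar> * \<bar>v $ k\<bar>))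
            = N * (v \<bullet> (fisher \<sigma> *\<^sub>v v)) - \<eta> * N * (\<Sum>j<d. \<bar>v $ j\<bar>)\<^sup>2"
          unfolding quad_sum[OF Fc v]
          by (simp add: sum_subtractf sum_distrib_left power2_eq_square sum_product mult_ac)
        moreover have "(\<Sum>j<d. \<bar>v $ j\<bar>)\<^sup>2 \<le> real d * (v \<bullet> v)"
          using sum_squared_le_sum_of_squares[of "\<lambda>j. \<bar>v $ j\<bar>" "{..<d}"] by (simp add: vv mult.commute)
        then have "\<eta> * N * (\<Sum>j<d. \<bar>v $ j\<bar>)\<^sup>2 \<le> \<eta> * N * (real d * (v \<bullet> v))"
          using \<eta> N by (intro mult_left_mono) auto
        moreover have "\<eta> * N * (real d * (v \<bullet> v)) = 1 / (2 * T) * N * (v \<bullet> v)"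
          using d_pos by (simp add: \<eta>_def)
        moreover have "N * (v \<bullet> (fisher \<sigma> *\<^sub>v v)) \<ge> N * ((v \<bullet> v) / T)"
          using low[OF v] T N by (intro mult_left_mono) (auto simp: divide_le_eq mult.commute)
        moreover have "N * ((v \<bullet> v) / T) = 1 / (2 * T) * N * (v \<bullet> v) + 1 / (2 * T) * N * (v \<bullet> v)"
          using T by (simp add: field_simps)
        ultimately show "1 / (2 * T) * num (probe \<omega>) t * (v \<bullet> v) \<le> v \<bullet> (info (probe \<omega>) t *\<^sub>v v)"
          using e1 unfolding N_def[symmetric] by linarith
      qed
    qed
    then show "excited (probe \<omega>)" unfolding excited_def using T by (intro exI[of _ "1 / (2 * T)"]) auto
  qed
qed

end

section \<open>The noise sum over the explorations\<close>

context raid_prob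
begin

lemma noise_square:
  shows "integrable M (\<lambda>\<omega>. (e t \<omega>)\<^sup>2)" "expectation (\<lambda>\<omega>. (e t \<omega>)\<^sup>2) \<le> 1 + C"
proof -
  have pw: "x\<^sup>2 \<le> 1 + \<bar>x\<bar> powr a" for x :: real
  proof (cases "\<bar>x\<bar> \<le> 1")
    case True
    then have "x\<^sup>2 \<le> 1" by (simp add: abs_square_le_1)
    then show ?thesis by (simp add: add_increasing2)
  next
    case False
    then have "\<bar>x\<bar> powr 2 \<le> \<bar>x\<bar> powr a" using a_gt_2 by (intro powr_mono) auto
    moreover have "\<bar>x\<bar> powr 2 = x\<^sup>2" using False by (simp add: powr_numeral)
    ultimately show ?thesis by simp
  qed
  have "(\<integral>\<^sup>+\<omega>. ennreal ((e t \<omega>)\<^sup>2) \<partial>M) \<le> (\<integral>\<^sup>+\<omega>. 1 + ennreal (\<bar>e t \<omega>\<bar> powr a) \<partial>M)"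
  proof (intro nn_integral_mono)
    fix \<omega>
    have "ennreal ((e t \<omega>)\<^sup>2) \<le> ennreal (1 + \<bar>e t \<omega>\<bar> powr a)" by (intro ennreal_leI pw)
    then show "ennreal ((e t \<omega>)\<^sup>2) \<le> 1 + ennreal (\<bar>e t \<omega>\<bar> powr a)" by simp
  qed
  also have "\<dots> = 1 + (\<integral>\<^sup>+\<omega>. ennreal (\<bar>e t \<omega>\<bar> powr a) \<partial>M)"
    by (subst nn_integral_add) (auto simp: emeasure_space_1)
  also have "\<dots> \<le> 1 + ennreal C" by (intro add_left_mono noise_moment)
  finally have le: "(\<integral>\<^sup>+\<omega>. ennreal ((e t \<omega>)\<^sup>2) \<partial>M) \<le> ennreal (1 + C)" using C_nonneg by simp
  then show int: "integrable M (\<lambda>\<omega>. (e t \<omega>)\<^sup>2)"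
    by (intro integrableI_nonneg) (auto intro: le_less_trans)
  have "ennreal (expectation (\<lambda>\<omega>. (e t \<omega>)\<^sup>2)) \<le> ennreal (1 + C)"
    using le nn_integral_eq_integral[OF int] by simp
  then show "expectation (\<lambda>\<omega>. (e t \<omega>)\<^sup>2) \<le> 1 + C" using C_nonneg by (subst (asm) ennreal_le_iff) auto
qed

text \<open>The history may contain all probing draws, future ones included: the noise is
  independent of the whole probing sequence, so exploration times count as fixed when the noise is
  integrated.\<close>

lemma measurable_eps_probes:
  assumes "range Inr \<subseteq> A"
  shows "(\<lambda>\<omega>. eps (probe \<omega>) s) \<in> borel_measurable (hist (case_sum e w) A)"
    and "w s \<in> borel_measurable (hist (case_sum e w) A)"
proof -
  have w: "w r \<in> borel_measurable (hist (case_sum e w) A)" for r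
    using measurable_hist_component[of "Inr r" A "case_sum e w"] assms by auto
  then show "w s \<in> borel_measurable (hist (case_sum e w) A)" .
  show "(\<lambda>\<omega>. eps (probe \<omega>) s) \<in> borel_measurable (hist (case_sum e w) A)"
    using w by (intro measurable_eps) (simp add: probe_def)
qed

text \<open>The exploration times are determined by the probing draws alone, so summing the tail
  probabilities over explorations costs the same as for an i.i.d. sequence indexed by the
  exploration count.\<close>
lemma AE_noise_tail:
  assumes \<beta>: "\<beta> > 0" "a * \<beta> > 1"
  shows "AE \<omega> in M. eventually (\<lambda>s. explores (probe \<omega>) s \<longrightarrow>
     \<bar>e (Suc s) \<omega>\<bar> \<le> num (probe \<omega>) (Suc s) powr \<beta>) sequentially"
proof -
  let ?G = "hist (case_sum e w) (range Inr)"
  have epsG[measurable]: "(\<lambda>\<omega>. eps (probe \<omega>) s) \<in> borel_measurable ?G" for s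
    by (rule measurable_eps_probes) auto
  have numG[measurable]: "(\<lambda>\<omega>. num (probe \<omega>) s) \<in> borel_measurable ?G" for s
    unfolding num_def by measurable
  have idG: "(\<lambda>\<omega>. \<omega>) \<in> measurable M ?G"
    by (intro measurable_to_hist) auto
  have epsM[measurable]: "(\<lambda>\<omega>. eps (probe \<omega>) s) \<in> borel_measurable M" for s
    using measurable_compose[OF idG epsG] by simp
  have numM[measurable]: "(\<lambda>\<omega>. num (probe \<omega>) s) \<in> borel_measurable M" for s
    using measurable_compose[OF idG numG] by simp
  \<comment> \<open>\<open>num\<close> at \<open>Suc s\<close> already counts the exploration
    decided at \<open>s\<close>, so the threshold is at least 1 on \<open>E s\<close>.\<close>
  define E where "E s = {\<omega> \<in> space M. eps (probe \<omega>) s = 1 \<and> \<bar>e (Suc s) \<omega>\<bar> > num (probe \<omega>) (Suc s) powr \<beta>}" for s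
  have E[measurable]: "E s \<in> sets M" for s unfolding E_def by measurable
  \<comment> \<open>Markov's inequality for the \<open>a\<close>-th moment bounds the failure
    probability at an exploration by \<open>C\<close> times this power, and
    \<open>sum_eps_powr_le\<close> sums it along each path.\<close>
  define g where "g s \<omega> = eps (probe \<omega>) s * num (probe \<omega>) (Suc s) powr (- (a * \<beta>))" for s \<omega>
  have gG[measurable]: "g s \<in> borel_measurable ?G" for s unfolding g_def by measurable
  have gM[measurable]: "g s \<in> borel_measurable M" for s unfolding g_def by measurable
  have g0: "g s \<omega> \<ge> 0" for s \<omega> by (simp add: g_def eps_range)
  have Ebound: "emeasure M (E s) \<le> ennreal C * (\<integral>\<^sup>+\<omega>. ennreal (g s \<omega>) \<partial>M)" for s
  proof -
    define f where "f = (\<lambda>(\<omega>, y). ennreal (g s \<omega>) * ennreal (\<bar>y :: real\<bar> powr a))"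
    have f: "f \<in> borel_measurable (?G \<Otimes>\<^sub>M borel)" unfolding f_def by measurable
    have ind: "indep_of ?G (e (Suc s))"
    proof -
      have "Inl (Suc s) \<notin> (range Inr :: (nat + nat) set)" by auto
      from indep_of_hist[OF indep_all this, of "\<lambda>p. p"] show ?thesis by simp
    qed
    have pw: "indicator (E s) \<omega> \<le> f (\<omega>, e (Suc s) \<omega>)" for \<omega>
    proof (cases "\<omega> \<in> E s")
      case True
      define n y where "n = num (probe \<omega>) (Suc s)" and "y = \<bar>e (Suc s) \<omega>\<bar>"
      have eps1: "eps (probe \<omega>) s = 1" and y: "n powr \<beta> < y" using True by (auto simp: E_def n_def y_def)
      have n: "n \<ge> 1" using eps1 num_nonneg[of "probe \<omega>" s] by (simp add: n_def num_def)
      have "n powr (a * \<beta>) = (n powr \<beta>) powr a" by (simp add: powr_powr mult.commute)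
      also have "\<dots> \<le> y powr a" using y a_gt_2 by (intro powr_mono2) auto
      finally have "1 \<le> g s \<omega> * y powr a"
        using eps1 n by (simp add: g_def n_def[symmetric] powr_minus_divide field_simps)
      then have "ennreal 1 \<le> ennreal (g s \<omega> * y powr a)" by (rule ennreal_leI)
      then show ?thesis using True g0 by (simp add: f_def y_def ennreal_mult)
    qed simp
    have "emeasure M (E s) = (\<integral>\<^sup>+\<omega>. indicator (E s) \<omega> \<partial>M)" by simp
    also have "\<dots> \<le> (\<integral>\<^sup>+\<omega>. f (\<omega>, e (Suc s) \<omega>) \<partial>M)" by (intro nn_integral_mono pw)
    also have "\<dots> = (\<integral>\<^sup>+\<omega>. (\<integral>\<^sup>+\<omega>'. f (\<omega>, e (Suc s) \<omega>') \<partial>M) \<partial>M)"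
      by (rule nn_integral_indep_pair[OF ind f])
    also have "\<dots> \<le> (\<integral>\<^sup>+\<omega>. ennreal C * ennreal (g s \<omega>) \<partial>M)"
    proof (rule nn_integral_mono)
      fix \<omega>
      have "(\<integral>\<^sup>+\<omega>'. f (\<omega>, e (Suc s) \<omega>') \<partial>M) = ennreal (g s \<omega>) * (\<integral>\<^sup>+\<omega>'. ennreal (\<bar>e (Suc s) \<omega>'\<bar> powr a) \<partial>M)"
        unfolding f_def by (simp add: nn_integral_cmult)
      also have "\<dots> \<le> ennreal (g s \<omega>) * ennreal C" by (intro mult_left_mono noise_moment) simp
      finally show "(\<integral>\<^sup>+\<omega>'. f (\<omega>, e (Suc s) \<omega>') \<partial>M) \<le> ennreal C * ennreal (g s \<omega>)" by (simp add: mult.commute)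
    qed
    also have "\<dots> = ennreal C * (\<integral>\<^sup>+\<omega>. ennreal (g s \<omega>) \<partial>M)" by (intro nn_integral_cmult) measurable
    finally show ?thesis .
  qed
  define Z where "Z = (\<Sum>k. real (Suc k) powr (- (a * \<beta>)))"
  have Z0: "Z \<ge> 0" using sum_eps_powr_le[OF \<beta>(2), where t = 0] by (simp add: Z_def)
  have sums: "(\<Sum>s<t. measure M (E s)) \<le> C * Z" for t
  proof -
    have "ennreal (\<Sum>s<t. measure M (E s)) = (\<Sum>s<t. emeasure M (E s))"
      by (simp add: emeasure_eq_measure sum_ennreal)
    also have "\<dots> \<le> (\<Sum>s<t. ennreal C * (\<integral>\<^sup>+\<omega>. ennreal (g s \<omega>) \<partial>M))" by (intro sum_mono Ebound)
    also have "\<dots> = ennreal C * (\<integral>\<^sup>+\<omega>. (\<Sum>s<t. ennreal (g s \<omega>)) \<partial>M)"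
      by (subst nn_integral_sum) (auto simp: sum_distrib_left)
    also have "\<dots> \<le> ennreal C * (\<integral>\<^sup>+\<omega>. ennreal Z \<partial>M)"
    proof (intro mult_left_mono nn_integral_mono)
      fix \<omega>
      have "(\<Sum>s<t. ennreal (g s \<omega>)) = ennreal (\<Sum>s<t. g s \<omega>)" using g0 by (simp add: sum_ennreal)
      also have "\<dots> \<le> ennreal Z"
        unfolding g_def Z_def by (intro ennreal_leI sum_eps_powr_le \<beta>(2))
      finally show "(\<Sum>s<t. ennreal (g s \<omega>)) \<le> ennreal Z" .
    qed simp
    also have "\<dots> = ennreal (C * Z)" using C_nonneg Z0 by (simp add: emeasure_space_1 ennreal_mult)
    finally show ?thesis using C_nonneg Z0 by (simp add: ennreal_le_iff)
  qed
  have "summable (\<lambda>s. measure M (E s))"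
    by (rule summableI_nonneg_bounded[OF _ sums]) simp
  then have "AE \<omega> in M. eventually (\<lambda>s. \<omega> \<in> space M - E s) sequentially"
    by (intro borel_cantelli_AE1) (auto simp: emeasure_eq_measure)
  then show ?thesis
  proof (rule AE_mp, intro AE_I2 impI)
    fix \<omega> assume "\<omega> \<in> space M" and ev: "eventually (\<lambda>s. \<omega> \<in> space M - E s) sequentially"
    show "eventually (\<lambda>s. explores (probe \<omega>) s \<longrightarrow>
     \<bar>e (Suc s) \<omega>\<bar> \<le> num (probe \<omega>) (Suc s) powr \<beta>) sequentially"
      using ev by (rule eventually_mono) (auto simp: E_def eps_def)
  qed
qed

text \<open>Replaces thresholds growing with the exploration count by one threshold for all
  \<open>s < t\<close>: \<open>N\<close> is of order at most \<open>t powr \<gamma> * ln t\<close>,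
  and \<beta> < 1/2 leaves room for the logarithm. The finitely many early terms have a fixed bound,
  while the threshold tends to infinity.\<close>

lemma noise_below_threshold:
  assumes ex: "excited (probe \<omega>)" and \<beta>: "0 < \<beta>" "\<beta> < 1/2"
    and tail: "eventually (\<lambda>s. explores (probe \<omega>) s \<longrightarrow>
     \<bar>e (Suc s) \<omega>\<bar> \<le> num (probe \<omega>) (Suc s) powr \<beta>) sequentially"
  shows "eventually (\<lambda>t. \<forall>s<t. explores (probe \<omega>) s \<longrightarrow> \<bar>e (Suc s) \<omega>\<bar> \<le> real t powr (\<gamma>/2)) sequentially"
proof -
  obtain D where D: "D > 0" "eventually (\<lambda>t. num (probe \<omega>) t \<le> D * (real t powr \<gamma> * ln (real t))) sequentially"
    using num_upper[OF ex] by blast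
  obtain S where S: "\<And>s. s \<ge> S \<Longrightarrow> explores (probe \<omega>) s \<Longrightarrow> \<bar>e (Suc s) \<omega>\<bar> \<le> num (probe \<omega>) (Suc s) powr \<beta>"
    using tail unfolding eventually_sequentially by blast
  define K where "K = (\<Sum>s<S. \<bar>e (Suc s) \<omega>\<bar>)"
  \<comment> \<open>The room left by \<beta> < 1/2: \<open>t powr (\<gamma> + \<rho>)\<close> raised
    to the power \<open>\<beta>\<close> is exactly \<open>t powr (\<gamma>/2)\<close>.\<close>
  define \<rho> where "\<rho> = \<gamma> / (2 * \<beta>) - \<gamma>"
  have \<rho>: "\<rho> > 0" using \<beta> gamma by (simp add: \<rho>_def field_simps)
  have "eventually (\<lambda>t::nat. x \<le> real t powr (\<gamma>/2)) sequentially" for x :: real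
    using gamma by real_asymp
  from this[of K] have ev1: "eventually (\<lambda>t::nat. K \<le> real t powr (\<gamma>/2)) sequentially" .
  have ev2: "eventually (\<lambda>t::nat. D * ln (real t) \<le> real t powr \<rho>) sequentially"
    using \<rho> D(1) by real_asymp
  show ?thesis using D(2) ev1 ev2 eventually_ge_at_top[of 1]
  proof eventually_elim
    case (elim t)
    show ?case
    proof (intro allI impI)
      fix s assume s: "s < t" "explores (probe \<omega>) s"
      show "\<bar>e (Suc s) \<omega>\<bar> \<le> real t powr (\<gamma>/2)"
      proof (cases "s \<ge> S")
        case True
        have "\<bar>e (Suc s) \<omega>\<bar> \<le> num (probe \<omega>) (Suc s) powr \<beta>" by (rule S[OF True s(2)])
        also have "\<dots> \<le> (real t powr (\<gamma> / (2 * \<beta>))) powr \<beta>"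
        proof (intro powr_mono2)
          have "num (probe \<omega>) (Suc s) \<le> num (probe \<omega>) t" using s by (intro num_mono) auto
          also have "\<dots> \<le> real t powr \<gamma> * (D * ln (real t))" using elim(1) by (simp add: mult_ac)
          also have "\<dots> \<le> real t powr \<gamma> * real t powr \<rho>" using elim(3) by (intro mult_left_mono) auto
          also have "\<dots> = real t powr (\<gamma> / (2 * \<beta>))" by (simp add: powr_add[symmetric] \<rho>_def)
          finally show "num (probe \<omega>) (Suc s) \<le> real t powr (\<gamma> / (2 * \<beta>))" .
        qed (use \<beta> num_nonneg in auto)
        also have "\<dots> = real t powr (\<gamma>/2)" using \<beta> by (simp add: powr_powr)
        finally show ?thesis .
      next
        case False
        have "\<bar>e (Suc s) \<omega>\<bar> \<le> K" unfolding K_def using False by (intro member_le_sum) auto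
        then show ?thesis using elim(2) by simp
      qed
    qed
  qed
qed

lemma AE_noise_sum:
  assumes j: "j < d"
  shows "AE \<omega> in M. \<exists>K. eventually (\<lambda>t. \<bar>noise_sum (probe \<omega>) (noise \<omega>) j t\<bar> \<le>
    K * (real t powr (\<gamma>/2) * ln (real t))) sequentially"
proof -
  \<comment> \<open>The weight of \<open>e (Suc s)\<close> involves the draw
    \<open>w (Suc s)\<close>, so the history holds all probing draws, together with the noise up to
    time \<open>s\<close>.\<close>
  let ?A = "\<lambda>s. range Inr \<union> Inl ` {..s} :: (nat + nat) set"
  interpret I: innovations M "\<lambda>s. hist (case_sum e w) (?A s)" "\<lambda>s. e (Suc s)" "1 + C"
  proof
    fix s
    have "Inl (Suc s) \<notin> ?A s" by auto
    from indep_of_hist[OF indep_all this, of "\<lambda>p. p"]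
    show "indep_of (hist (case_sum e w) (?A s)) (e (Suc s))" by simp
    show "sets (hist (case_sum e w) (?A s)) \<subseteq> sets (hist (case_sum e w) (?A (Suc s)))"
      by (intro sets_hist_mono) auto
    show "e (Suc s) \<in> borel_measurable (hist (case_sum e w) (?A (Suc s)))"
      using measurable_hist_component[of "Inl (Suc s)" "?A (Suc s)" "case_sum e w"] by simp
  qed (auto simp: noise_int noise_mean noise_square)
  define b where "b \<omega> s = interior_ind (w (Suc s) \<omega>) * feature (w (Suc s) \<omega>) $ j" for \<omega> s
  define B where "B = feature_bound"
  have B: "B \<ge> 1" by (simp add: B_def feature_bound_ge_1)
  have b: "\<bar>b \<omega> s\<bar> \<le> B" for \<omega> s
  proof -
    have "\<bar>b \<omega> s\<bar> \<le> 1 * B"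
      unfolding b_def abs_mult B_def using interior_ind_range[of "w (Suc s) \<omega>"] feature_bound_ge_1 j
      by (intro mult_mono feature_abs_le) auto
    then show ?thesis by simp
  qed
  have zm: "(\<lambda>\<omega>. eps (probe \<omega>) s * b \<omega> s) \<in> borel_measurable (hist (case_sum e w) (?A s))" for s
  proof -
    have [measurable]: "(\<lambda>\<omega>. eps (probe \<omega>) s) \<in> borel_measurable (hist (case_sum e w) (?A s))"
      "w (Suc s) \<in> borel_measurable (hist (case_sum e w) (?A s))"
      by (intro measurable_eps_probes; simp)+
    have [measurable]: "(\<lambda>p. feature p $ j) \<in> borel_measurable borel" using j by simp
    show ?thesis unfolding b_def by measurable
  qed
  \<comment> \<open>The midpoint of \<open>1 / a\<close> and \<open>1 / 2\<close>: above the first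
    for a summable tail, below the second for \<open>noise_below_threshold\<close>.\<close>
  define \<beta> where "\<beta> = (1 / a + 1 / 2) / 2"
  have \<beta>: "0 < \<beta>" "\<beta> < 1/2" "a * \<beta> > 1" using a_gt_2 by (auto simp: \<beta>_def field_simps)
  \<comment> \<open>At this scale a term is unclipped once its noise is at most
    \<open>t powr (\<gamma>/2)\<close>, and the compensator is at most
    \<open>2 * V * D * ln t\<close>, comparable to the Chernoff level. Dividing by
    \<open>c t\<close> gives the order \<open>t powr (\<gamma>/2) * ln t\<close>.\<close>
  define c where "c t = real t powr (- (\<gamma>/2)) / B" for t :: nat
  from I.AE_clipped_sum_abs_le[of "\<lambda>s \<omega>. eps (probe \<omega>) s * b \<omega> s" c, OF zm] AE_excited AE_noise_tail[OF \<beta>(1,3)]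
  show ?thesis
  proof eventually_elim
    case (elim \<omega>)
    obtain D where D: "D > 0" "eventually (\<lambda>t. num (probe \<omega>) t \<le> D * (real t powr \<gamma> * ln (real t))) sequentially"
      using num_upper[OF elim(2)] by blast
    define V where "V = 1 + C"
    have V: "V \<ge> 0" using C_nonneg by (simp add: V_def)
    define z where "z s = eps (probe \<omega>) s * b \<omega> s * e (Suc s) \<omega>" for s
    have "eventually (\<lambda>t. \<bar>noise_sum (probe \<omega>) (noise \<omega>) j t\<bar> \<le>
        ((2 * V * D + 2) * B) * (real t powr (\<gamma>/2) * ln (real t))) sequentially"
      using elim(1)[folded V_def] D(2) noise_below_threshold[OF elim(2) \<beta>(1,2) elim(3)] eventually_ge_at_top[of 1]
    proof eventually_elim
      case (elim t)
      define r where "r = real t powr (\<gamma>/2)"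
      have r: "r > 0" using elim(4) by (simp add: r_def)
      have c: "c t = 1 / (r * B)" by (simp add: c_def r_def powr_minus_divide)
      have r2: "real t powr \<gamma> = r\<^sup>2" by (simp add: r_def power2_eq_square powr_add[symmetric])
      have clip: "clip (c t * z s) = c t * z s" if s: "s < t" for s
      proof -
        have "\<bar>z s\<bar> \<le> B * r"
        proof (cases "explores (probe \<omega>) s")
          case True
          have "\<bar>z s\<bar> \<le> 1 * B * r"
            unfolding z_def abs_mult using eps_range[of "probe \<omega>" s] b[of \<omega> s] elim(3) s True B
            by (intro mult_mono) (auto simp: r_def)
          then show ?thesis by simp
        next
          case False
          then show ?thesis using B r by (simp add: z_def eps_def)
        qed
        then have "\<bar>c t * z s\<bar> \<le> 1" using B r by (simp add: c abs_mult field_simps)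
        then show ?thesis by (simp add: clip_def)
      qed
      have sq: "(\<Sum>s<t. (eps (probe \<omega>) s * b \<omega> s)\<^sup>2) \<le> B\<^sup>2 * num (probe \<omega>) t"
      proof -
        have "(\<Sum>s<t. (eps (probe \<omega>) s * b \<omega> s)\<^sup>2) \<le> (\<Sum>s<t. B\<^sup>2 * eps (probe \<omega>) s)"
        proof (intro sum_mono)
          fix s
          have "(b \<omega> s)\<^sup>2 \<le> B\<^sup>2" using b[of \<omega> s] B by (simp add: abs_le_square_iff[symmetric])
          then show "(eps (probe \<omega>) s * b \<omega> s)\<^sup>2 \<le> B\<^sup>2 * eps (probe \<omega>) s"
            using eps_range(1)[of "probe \<omega>" s]
            by (simp add: power_mult_distrib eps_range(3) mult.commute[of "B\<^sup>2"] mult_left_mono)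
        qed
        then show ?thesis by (simp add: num_def sum_distrib_left)
      qed
      have "c t * \<bar>noise_sum (probe \<omega>) (noise \<omega>) j t\<bar> = \<bar>\<Sum>s<t. c t * z s\<bar>"
      proof -
        have "noise_sum (probe \<omega>) (noise \<omega>) j t = (\<Sum>s<t. z s)"
          by (simp add: noise_sum_def z_def b_def probe_def noise_def)
        moreover have "c t \<ge> 0" using B r by (simp add: c)
        ultimately show ?thesis by (simp only: sum_distrib_left[symmetric] abs_mult abs_of_nonneg)
      qed
      also have "\<dots> = \<bar>\<Sum>s<t. clip (c t * z s)\<bar>" using clip by simp
      also have "\<dots> \<le> 2 * V * (c t)\<^sup>2 * (\<Sum>s<t. (eps (probe \<omega>) s * b \<omega> s)\<^sup>2) + 2 * ln (real t)"
        using elim(1) by (simp add: z_def mult.assoc)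
      also have "2 * V * (c t)\<^sup>2 * (\<Sum>s<t. (eps (probe \<omega>) s * b \<omega> s)\<^sup>2) \<le> 2 * V * (c t)\<^sup>2 * (B\<^sup>2 * num (probe \<omega>) t)"
        using V sq by (intro mult_left_mono) auto
      also have "2 * V * (c t)\<^sup>2 * (B\<^sup>2 * num (probe \<omega>) t) \<le> 2 * V * (c t)\<^sup>2 * (B\<^sup>2 * (D * (real t powr \<gamma> * ln (real t))))"
        using V elim(2) by (intro mult_left_mono) auto
      also have "\<dots> = 2 * V * D * ln (real t)"
        using r B by (simp add: c r2 power2_eq_square field_simps)
      finally have "c t * \<bar>noise_sum (probe \<omega>) (noise \<omega>) j t\<bar> \<le> (2 * V * D + 2) * ln (real t)"
        by (simp add: algebra_simps)
      then show ?case unfolding r_def[symmetric] c using r B by (simp add: field_simps)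
    qed
    then show ?case by blast
  qed
qed

lemma AE_agent:
  "AE \<omega> in M. (\<exists>K\<ge>0. eventually (\<lambda>t. err (probe \<omega>) (noise \<omega>) t \<bullet> err (probe \<omega>) (noise \<omega>) t
      \<le> K * real t powr (- \<gamma>)) sequentially) \<and>
    (\<lambda>t. \<Sum>\<tau>=1..t. (resp (probe \<omega>) (noise \<omega>) \<tau> - xdes)\<^sup>2) \<in> O(\<lambda>t. real t powr \<gamma> * ln (real t))"
proof -
  have "AE \<omega> in M. \<forall>j\<in>{..<d}. \<exists>K. eventually (\<lambda>t. \<bar>noise_sum (probe \<omega>) (noise \<omega>) j t\<bar> \<le>
    K * (real t powr (\<gamma>/2) * ln (real t))) sequentially"
    using AE_noise_sum by (intro AE_finite_allI) auto
  with AE_excited show ?thesis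
  proof eventually_elim
    case (elim \<omega>)
    then have K: "\<exists>K\<ge>0. eventually (\<lambda>t. err (probe \<omega>) (noise \<omega>) t \<bullet> err (probe \<omega>) (noise \<omega>) t
        \<le> K * real t powr (- \<gamma>)) sequentially"
      by (intro err_bound) auto
    with regret_bound[OF elim(1)] show ?case by blast
  qed
qed

end

theorem theorem3:
  fixes M :: "'w measure" and n d :: nat
    and lo hi m Mx xdes :: "nat \<Rightarrow> real"
    and \<theta>s \<theta>0 :: "nat \<Rightarrow> real vec" and \<Sigma>0 :: "nat \<Rightarrow> real mat"
    and e w :: "nat \<Rightarrow> nat \<Rightarrow> 'w \<Rightarrow> real"
    and \<gamma> \<sigma> :: real
  assumes "prob_space M"
    and interval: "\<And>i. i < n \<Longrightarrow> lo i < hi i"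
    and mM: "\<And>i. i < n \<Longrightarrow> 0 < m i \<and> m i \<le> Mx i"
    and theta_star: "\<And>i. i < n \<Longrightarrow> \<theta>s i \<in> Theta d (lo i) (hi i) (m i) (Mx i)"
    and xdes_int: "\<And>i. i < n \<Longrightarrow> lo i < xdes i \<and> xdes i < hi i"
    and init_Sigma: "\<And>i. i < n \<Longrightarrow> pos_def d (\<Sigma>0 i)"
    and init_theta: "\<And>i. i < n \<Longrightarrow> \<theta>0 i \<in> carrier_vec d"
    and gamma: "2/3 \<le> \<gamma>" "\<gamma> < 1"
    and sigma: "\<sigma> > 0"
    and noise_meas: "\<And>i t. i < n \<Longrightarrow> e i t \<in> borel_measurable M"
    and noise_ident: "\<And>i t. i < n \<Longrightarrow> distr M borel (e i t) = distr M borel (e i 0)"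
    and noise_mean: "\<And>i t. i < n \<Longrightarrow> integrable M (e i t) \<and> prob_space.expectation M (e i t) = 0"
    and noise_moment: "\<And>i. i < n \<Longrightarrow> \<exists>a>2. \<exists>C::real. \<forall>t.
                         (\<integral>\<^sup>+ \<omega>. ennreal (\<bar>e i t \<omega>\<bar> powr a) \<partial>M) \<le> ennreal C"
    and probing: "\<And>i t. i < n \<Longrightarrow> distributed M lborel (w i t) (normal_density 0 \<sigma>)"
    and indep: "\<And>i. i < n \<Longrightarrow> prob_space.indep_vars M (\<lambda>_. borel)
                   (\<lambda>k. case k of Inl t \<Rightarrow> e i t | Inr t \<Rightarrow> w i t) UNIV"
  shows "AE \<omega> in M.
     (\<forall>i<n. (\<lambda>t. let v = raid_theta d (lo i) (hi i) (\<theta>s i) (\<Sigma>0 i) (\<theta>0 i) (xdes i) \<gamma>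
                              (\<lambda>\<tau>. w i \<tau> \<omega>) (\<lambda>\<tau>. e i \<tau> \<omega>) t - \<theta>s i
                      in v \<bullet> v) \<in> O(\<lambda>t. real t powr (- \<gamma>)))
   \<and> (\<lambda>t. \<Sum>\<tau>=1..t. \<Sum>i<n.
          (raid_x d (lo i) (hi i) (\<theta>s i) (\<Sigma>0 i) (\<theta>0 i) (xdes i) \<gamma>
             (\<lambda>\<tau>. w i \<tau> \<omega>) (\<lambda>\<tau>. e i \<tau> \<omega>) \<tau> - xdes i)\<^sup>2)
       \<in> O(\<lambda>t. real t powr \<gamma> * ln (real t))"
proof -
  interpret prob_space M by fact
  define th where "th i \<omega> t = raid_theta d (lo i) (hi i) (\<theta>s i) (\<Sigma>0 i) (\<theta>0 i) (xdes i) \<gamma>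
      (\<lambda>\<tau>. w i \<tau> \<omega>) (\<lambda>\<tau>. e i \<tau> \<omega>) t - \<theta>s i" for i \<omega> t
  define rx where "rx i \<omega> \<tau> = (raid_x d (lo i) (hi i) (\<theta>s i) (\<Sigma>0 i) (\<theta>0 i) (xdes i) \<gamma>
      (\<lambda>\<tau>. w i \<tau> \<omega>) (\<lambda>\<tau>. e i \<tau> \<omega>) \<tau> - xdes i)\<^sup>2" for i \<omega> \<tau>
  have "AE \<omega> in M. (\<lambda>t. th i \<omega> t \<bullet> th i \<omega> t) \<in> O(\<lambda>t. real t powr (- \<gamma>)) \<and>
      (\<lambda>t. \<Sum>\<tau>=1..t. rx i \<omega> \<tau>) \<in> O(\<lambda>t. real t powr \<gamma> * ln (real t))" if i: "i < n" for i
  proof -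
    obtain a C where aC: "a > 2" "\<And>t. (\<integral>\<^sup>+ \<omega>. ennreal (\<bar>e i t \<omega>\<bar> powr a) \<partial>M) \<le> ennreal C"
      using noise_moment[OF i] by blast
    \<comment> \<open>The given moment constant is an arbitrary real, and \<open>ennreal\<close>
      sends negative reals to 0; \<open>max C 0\<close> makes it nonnegative.\<close>
    interpret R: raid_prob M d "lo i" "hi i" "m i" "Mx i" "\<theta>s i" "\<Sigma>0 i" "\<theta>0 i" "xdes i" \<gamma> "e i" "w i" \<sigma> a "max C 0"
    proof
      show "(\<integral>\<^sup>+ \<omega>. ennreal (\<bar>e i t \<omega>\<bar> powr a) \<partial>M) \<le> ennreal (max C 0)" for t
        using order_trans[OF aC(2) ennreal_leI[of C "max C 0"]] by simp
      show "indep_vars (\<lambda>_. borel) (case_sum (e i) (w i)) UNIV" using indep[OF i] by simp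
    qed (use i interval mM theta_star xdes_int init_Sigma init_theta gamma sigma noise_mean probing aC in auto)
    show ?thesis using R.AE_agent
    proof eventually_elim
      case (elim \<omega>)
      then obtain K where K: "eventually (\<lambda>t. th i \<omega> t \<bullet> th i \<omega> t \<le> K * real t powr (- \<gamma>)) sequentially"
        by (auto simp: th_def R.err_def R.probe_def R.noise_def raid_theta_def)
      have "(\<lambda>t. th i \<omega> t \<bullet> th i \<omega> t) \<in> O(\<lambda>t. real t powr (- \<gamma>))"
        using K by (intro bigoI[of _ K]) (simp add: scalar_prod_self_nonneg)
      moreover have "(\<lambda>t. \<Sum>\<tau>=1..t. rx i \<omega> \<tau>) \<in> O(\<lambda>t. real t powr \<gamma> * ln (real t))"
        using elim by (simp add: rx_def R.probe_def R.noise_def)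
      ultimately show ?case by simp
    qed
  qed
  then have "AE \<omega> in M. \<forall>i\<in>{..<n}. (\<lambda>t. th i \<omega> t \<bullet> th i \<omega> t) \<in> O(\<lambda>t. real t powr (- \<gamma>)) \<and>
      (\<lambda>t. \<Sum>\<tau>=1..t. rx i \<omega> \<tau>) \<in> O(\<lambda>t. real t powr \<gamma> * ln (real t))"
    by (intro AE_finite_allI) auto
  then have "AE \<omega> in M. (\<forall>i<n. (\<lambda>t. th i \<omega> t \<bullet> th i \<omega> t) \<in> O(\<lambda>t. real t powr (- \<gamma>))) \<and>
      (\<lambda>t. \<Sum>\<tau>=1..t. \<Sum>i<n. rx i \<omega> \<tau>) \<in> O(\<lambda>t. real t powr \<gamma> * ln (real t))"
  proof eventually_elim
    case (elim \<omega>)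
    then have "(\<lambda>t. \<Sum>i<n. \<Sum>\<tau>=1..t. rx i \<omega> \<tau>) \<in> O(\<lambda>t. real t powr \<gamma> * ln (real t))"
      by (intro big_sum_in_bigo) auto
    then show ?case using elim by (subst sum.swap) auto
  qed
  then show ?thesis by (simp add: th_def rx_def Let_def)
qed

end
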